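(* Suppose that $\gamma\in\mathbb{Q}$ and $\delta\in\mathbb{Z}$ are multiplicatively independent and let \[\Sigma=\{\gamma^a\delta^b : a,b\in\mathbb{N}\}.\] Then for any $\alpha\in\mathbb{A}/\mathbb{Q}$ with $\alpha_\infty\notin\mathbb{Q}$ the set \[\Sigma\alpha=\{\sigma\alpha:\sigma\in\Sigma\}\subseteq\mathbb{A}/\mathbb{Q}\] is dense in $\mathbb{A}/\mathbb{Q}$.
   Context: $\mathbb{N}$ denotes the positive integers. $\mathbb{A}$ is the ring of rational adeles with its usual restricted product topology, $\mathbb{Q}$ is embedded diagonally in $\mathbb{A}$, and $\mathbb{A}/\mathbb{Q}$ is the (compact) quotient group with the quotient topology. For $\sigma\in\mathbb{Q}$, the natural action of $\sigma$ on $\mathbb{A}/\mathbb{Q}$ is the endomorphism induced by multiplication by (the diagonal image of) $\sigma$ on $\mathbb{A}$. For $\alpha\in\mathbb{A}/\mathbb{Q}$, $\alpha_\infty$ denotes the real coordinate of its representative in the fundamental domain $[0,1)\times\prod_p\mathbb{Z}_p$; whether $\alpha_\infty\in\mathbb{Q}$ does not depend on the choice of representative of $\alpha$ in $\mathbb{A}$. Two nonzero rationals $\gamma,\delta$ are multiplicatively independent if $\gamma^m\delta^n=1$ with $m,n\in\mathbb{Z}$ implies $m=n=0$ (equivalently, $\log|\gamma|$ and $\log|\delta|$ are linearly independent over $\mathbb{Q}$). *)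

theory Defs
  imports "HOL-Algebra.QuotRing" "HOL-Analysis.Analysis"
begin

text \<open>\<^term>\<open>quotient_of x\<close> is the reduced fraction (numerator, denominator).\<close>

definition padic_val :: "nat \<Rightarrow> rat \<Rightarrow> int" where
  "padic_val p x = int (multiplicity (int p) (fst (quotient_of x)))
                 - int (multiplicity (int p) (snd (quotient_of x)))"

definition padic_abs :: "nat \<Rightarrow> rat \<Rightarrow> real" where
  "padic_abs p x = (if x = 0 then 0 else real p powi (- padic_val p x))"

lemma padic_val_divide:
  assumes "prime p" "a \<noteq> 0" "b \<noteq> 0"
  shows "padic_val p (of_int a / of_int b)
           = int (multiplicity (int p) a) - int (multiplicity (int p) b)"
proof -
  obtain c d where cd: "quotient_of (of_int a / of_int b) = (c, d)" by fastforce
  have d: "d > 0" using quotient_of_denom_pos[OF cd] .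
  have eq: "(of_int a / of_int b :: rat) = of_int c / of_int d" using quotient_of_div[OF cd] .
  then have "(of_int (a * d) :: rat) = of_int (c * b)"
    using assms d by (simp add: field_simps)
  then have ad: "a * d = c * b" by (simp only: of_int_eq_iff)
  have c: "c \<noteq> 0" using ad assms d by auto
  have pp: "prime_elem (int p)" using assms(1) by (simp add: prime_imp_prime_elem)
  have "multiplicity (int p) (a * d) = multiplicity (int p) (c * b)" using ad by simp
  then have "multiplicity (int p) a + multiplicity (int p) d
               = multiplicity (int p) c + multiplicity (int p) b"
    using prime_elem_multiplicity_mult_distrib[OF pp] assms c d by simp
  then show ?thesis by (simp add: padic_val_def cd)
qed

lemma rat_cases_int:
  obtains a b :: int where "b > 0" "(x :: rat) = of_int a / of_int b" "coprime a b"
proof -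
  obtain a b where "quotient_of x = (a, b)" by fastforce
  then show ?thesis using that[of b a] quotient_of_denom_pos quotient_of_div quotient_of_coprime by blast
qed

lemma padic_abs_0 [simp]: "padic_abs p 0 = 0"
  by (simp add: padic_abs_def)

lemma padic_abs_nonneg [simp]: "padic_abs p x \<ge> 0"
  by (simp add: padic_abs_def)

lemma padic_abs_minus [simp]: "padic_abs p (- x) = padic_abs p x"
proof -
  have "quotient_of (- x) = (- fst (quotient_of x), snd (quotient_of x))"
    by (simp add: rat_uminus_code split: prod.split)
  moreover have "multiplicity (int p) (- a) = multiplicity (int p) a" for a
    by (simp add: multiplicity_def)
  ultimately show ?thesis by (simp add: padic_abs_def padic_val_def)
qed

lemma padic_abs_minus_commute: "padic_abs p (x - y) = padic_abs p (y - x)"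
  by (metis minus_diff_eq padic_abs_minus)

context
  fixes p :: nat
  assumes p: "prime p"
begin

lemma padic_prime_gt_1: "real p > 1"
  using p prime_gt_1_nat by simp

lemma padic_abs_eq_0_iff [simp]: "padic_abs p x = 0 \<longleftrightarrow> x = 0"
  using padic_prime_gt_1 by (auto simp: padic_abs_def)

lemma padic_abs_mult: "padic_abs p (x * y) = padic_abs p x * padic_abs p y"
proof (cases "x = 0 \<or> y = 0")
  case False
  obtain a b where ab: "b > 0" "x = of_int a / of_int b" by (metis rat_cases_int)
  obtain c d where cd: "d > 0" "y = of_int c / of_int d" by (metis rat_cases_int)
  have nz: "a \<noteq> 0" "c \<noteq> 0" using False ab cd by auto
  have pp: "prime_elem (int p)" using p by (simp add: prime_imp_prime_elem)
  have "x * y = of_int (a * c) / of_int (b * d)" using ab cd by simp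
  then have "padic_val p (x * y) = padic_val p x + padic_val p y"
    using padic_val_divide[OF p, of "a * c" "b * d"] padic_val_divide[OF p, of a b]
      padic_val_divide[OF p, of c d] ab cd nz prime_elem_multiplicity_mult_distrib[OF pp]
    by simp
  then show ?thesis using False padic_prime_gt_1
    by (simp add: padic_abs_def power_int_diff power_int_minus field_simps power_int_add)
qed auto

lemma padic_abs_1 [simp]: "padic_abs p 1 = 1"
  by (simp add: padic_abs_def padic_val_def)

lemma padic_abs_of_int_le_1 [simp]: "padic_abs p (of_int n) \<le> 1"
proof (cases "n = 0")
  case False
  then have "padic_val p (of_int n) \<ge> 0" using padic_val_divide[OF p, of n 1] by simp
  then show ?thesis using padic_prime_gt_1
    by (simp add: padic_abs_def power_int_minus inverse_le_1_iff)
qed auto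

lemma padic_abs_add: "padic_abs p (x + y) \<le> max (padic_abs p x) (padic_abs p y)"
proof (cases "x = 0 \<or> y = 0 \<or> x + y = 0")
  case False
  obtain a b where ab: "b > 0" "x = of_int a / of_int b" by (metis rat_cases_int)
  obtain c d where cd: "d > 0" "y = of_int c / of_int d" by (metis rat_cases_int)
  define u where "u = a * d"
  define v where "v = c * b"
  define w where "w = b * d"
  have w: "w \<noteq> 0" using ab cd by (simp add: w_def)
  have x: "x = of_int u / of_int w" using ab cd by (simp add: u_def w_def)
  have y: "y = of_int v / of_int w" using ab cd by (simp add: v_def w_def)
  have xy: "x + y = of_int (u + v) / of_int w" by (simp add: x y add_divide_distrib)
  have nz: "u \<noteq> 0" "v \<noteq> 0" "u + v \<noteq> 0"
    using False w unfolding xy by (auto simp: x y)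
  have nu: "\<not> is_unit (int p)" using p by auto
  define m where "m = min (multiplicity (int p) u) (multiplicity (int p) v)"
  have "int p ^ m dvd u + v" 
    by (intro dvd_add multiplicity_dvd') (auto simp: m_def)
  then have "m \<le> multiplicity (int p) (u + v)"
    using nz nu by (intro multiplicity_geI) auto
  then have "padic_val p x \<le> padic_val p (x + y) \<or> padic_val p y \<le> padic_val p (x + y)"
    unfolding xy unfolding x y padic_val_divide[OF p nz(1) w] padic_val_divide[OF p nz(2) w]
      padic_val_divide[OF p nz(3) w] by (auto simp: m_def)
  then have "padic_abs p (x + y) \<le> padic_abs p x \<or> padic_abs p (x + y) \<le> padic_abs p y"
    using False padic_prime_gt_1 by (auto simp: padic_abs_def intro!: power_int_increasing)
  then show ?thesis by auto
qed (auto simp: le_max_iff_disj)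

lemma padic_abs_diff: "padic_abs p (x - y) \<le> max (padic_abs p x) (padic_abs p y)"
  using padic_abs_add[of x "- y"] by simp

lemma padic_abs_add_le: "padic_abs p (x + y) \<le> padic_abs p x + padic_abs p y"
  using padic_abs_add[of x y] padic_abs_nonneg[of p x] padic_abs_nonneg[of p y] by linarith

lemma padic_abs_diff_abs: "\<bar>padic_abs p x - padic_abs p y\<bar> \<le> padic_abs p (x - y)"
  using padic_abs_add_le[of "x - y" y] padic_abs_add_le[of "y - x" x] padic_abs_minus_commute[of p x y]
  by simp

end

lemma rat_integral_everywhere:
  assumes "\<And>p. prime p \<Longrightarrow> padic_abs p x \<le> 1"
  shows "x \<in> \<int>"
proof -
  obtain a b where ab: "b > 0" "x = of_int a / of_int b" "coprime a b" by (metis rat_cases_int)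
  have "b = 1"
  proof (rule ccontr)
    assume "b \<noteq> 1"
    then have "nat b \<noteq> 1" using ab(1) by auto
    then obtain q where q: "prime q" "q dvd nat b" using prime_factor_nat by blast
    have qb: "int q dvd b" using q(2) ab(1) by (metis int_dvd_int_iff int_nat_eq less_imp_le)
    have pp: "prime_elem (int q)" using q(1) by (simp add: prime_imp_prime_elem)
    have qa: "\<not> int q dvd a"
      using qb ab(3) pp by (meson coprime_common_divisor prime_elem_not_unit)
    then have a: "a \<noteq> 0" by auto
    have "multiplicity (int q) b > 0" using qb ab(1) pp
      by (simp add: prime_multiplicity_gt_zero_iff)
    then have "padic_val q x < 0" using padic_val_divide[OF q(1) a, of b] ab qa
      by (simp add: not_dvd_imp_multiplicity_0)
    then have "padic_abs q x > 1"
      using a ab(1,2) one_less_power_int[OF padic_prime_gt_1[OF q(1)], of "- padic_val q x"]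
      by (simp add: padic_abs_def)
    then show False using assms[OF q(1)] by simp
  qed
  then show ?thesis using ab by simp
qed

lemma finite_padic_abs_gt_1: "finite {p. prime p \<and> \<not> padic_abs p x \<le> 1}"
proof -
  obtain a b where ab: "b > 0" "x = of_int a / of_int b" by (metis rat_cases_int)
  have "{p. prime p \<and> \<not> padic_abs p x \<le> 1} \<subseteq> {..nat b}"
  proof safe
    fix p assume pr: "prime p" and gt: "\<not> padic_abs p x \<le> 1"
    have "int p dvd b"
    proof (rule ccontr)
      assume "\<not> int p dvd b"
      then have "multiplicity (int p) b = 0" by (simp add: not_dvd_imp_multiplicity_0)
      then have "padic_abs p (of_int b) = 1"
        using padic_val_divide[OF pr, of b 1] ab by (simp add: padic_abs_def)
      moreover have "x * of_int b = of_int a" using ab by simp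
      ultimately have "padic_abs p x = padic_abs p (of_int a)"
        using padic_abs_mult[OF pr, of x "of_int b"] by simp
      then show False using gt pr by simp
    qed
    then show "p \<le> nat b" using ab(1) zdvd_imp_le by fastforce
  qed
  then show ?thesis using finite_subset by blast
qed

lemma padic_principal_part:
  assumes p: "prime p"
  obtains r where "padic_abs p (x - r) \<le> 1" "\<And>q. prime q \<Longrightarrow> q \<noteq> p \<Longrightarrow> padic_abs q r \<le> 1"
proof -
  obtain a b where ab: "b > 0" "x = of_int a / of_int b" by (metis rat_cases_int)
  define k where "k = multiplicity (int p) b"
  have nu: "\<not> is_unit (int p)" using p by auto
  obtain m where m: "b = int p ^ k * m" "\<not> int p dvd m"
    using multiplicity_decompose'[of b "int p"] nu ab(1) unfolding k_def by (metis less_irrefl)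
  have pp: "prime (int p)" using p by simp
  have m0: "m \<noteq> 0" using m by auto
  have p0: "int p \<noteq> 0" using pp by auto
  have "coprime (int p ^ k) m" using m(2) pp by (simp add: prime_imp_coprime)
  then obtain u v where uv: "u * int p ^ k + v * m = 1"
    using bezout_int[of "int p ^ k" m] by (auto simp: coprime_iff_gcd_eq_1)
  define r :: rat where "r = of_int (a * v) / of_int (int p ^ k)"
  have "x - r = of_int (a * u) / of_int m"
  proof -
    have "of_int a = (of_int a * of_int (u * int p ^ k + v * m) :: rat)" by (simp add: uv)
    then have e: "of_int a = (of_int (a * u) * of_int (int p ^ k) + of_int (a * v) * of_int m :: rat)"
      by (simp add: algebra_simps)
    show ?thesis unfolding r_def ab(2) m(1) using p0 m0
      by (subst e) (simp add: field_simps)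
  qed
  moreover have "padic_abs p (of_int (a * u) / of_int m) \<le> 1"
  proof (cases "a * u = 0")
    case False
    then have "padic_val p (of_int (a * u) / of_int m) \<ge> 0"
      using padic_val_divide[OF p False m0] m(2) by (simp add: not_dvd_imp_multiplicity_0)
    then show ?thesis using padic_prime_gt_1[OF p]
      by (simp add: padic_abs_def power_int_minus inverse_le_1_iff)
  qed auto
  moreover have "padic_abs q r \<le> 1" if q: "prime q" "q \<noteq> p" for q
  proof (cases "a * v = 0")
    case False
    have "\<not> int q dvd int p ^ k"
      using q p primes_dvd_imp_eq prime_dvd_power_nat by (metis int_dvd_int_iff of_nat_power)
    then have "padic_val q r \<ge> 0"
      using padic_val_divide[OF q(1) False, of "int p ^ k"] p0
      by (simp add: r_def not_dvd_imp_multiplicity_0)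
    then show ?thesis using padic_prime_gt_1[OF q(1)]
      by (simp add: padic_abs_def power_int_minus inverse_le_1_iff)
  qed (auto simp: r_def)
  ultimately show ?thesis using that by metis
qed

definition padic_Cauchy :: "nat \<Rightarrow> (nat \<Rightarrow> rat) \<Rightarrow> bool" where
  "padic_Cauchy p X \<longleftrightarrow> (\<forall>e>0. \<exists>N. \<forall>m\<ge>N. \<forall>n\<ge>N. padic_abs p (X m - X n) < e)"

type_synonym padic = "(nat \<Rightarrow> rat) set"

text \<open>\<open>Q\<^sub>p\<close> is the completion of the rationals for the \<open>p\<close>-adic absolute value, built as the ring of
  \<open>p\<close>-adic Cauchy sequences modulo the ideal of null sequences. Its elements are cosets of null
  sequences. All notions below are meaningful for prime \<open>p\<close> only.\<close>

definition padic_Cauchy_ring :: "nat \<Rightarrow> (nat \<Rightarrow> rat) ring" where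
  "padic_Cauchy_ring p =
    \<lparr>carrier = {X. padic_Cauchy p X}, monoid.mult = (\<lambda>X Y n. X n * Y n), one = (\<lambda>n. 1),
     zero = (\<lambda>n. 0), add = (\<lambda>X Y n. X n + Y n)\<rparr>"

definition padic_null :: "nat \<Rightarrow> padic" where
  "padic_null p = {X. (\<lambda>n. padic_abs p (X n)) \<longlonglongrightarrow> 0}"

definition Qp :: "nat \<Rightarrow> padic ring" where
  "Qp p = padic_Cauchy_ring p Quot padic_null p"

definition Qp_of_rat :: "nat \<Rightarrow> rat \<Rightarrow> padic" where
  "Qp_of_rat p x = padic_null p +>\<^bsub>padic_Cauchy_ring p\<^esub> (\<lambda>n. x)"

text \<open>The limit depends only on the coset (lemma \<open>Qp_norm_tendsto\<close>).\<close>

definition Qp_norm :: "nat \<Rightarrow> padic \<Rightarrow> real" where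
  "Qp_norm p x = (THE r. \<forall>X\<in>x. (\<lambda>n. padic_abs p (X n)) \<longlonglongrightarrow> r)"

definition Zp :: "nat \<Rightarrow> padic set" where
  "Zp p = {x \<in> carrier (Qp p). Qp_norm p x \<le> 1}"

text \<open>The value 0 off the carrier is a dummy: the locale \<^locale>\<open>Metric_space\<close> wants a distance that is
  nonnegative and symmetric on the whole type.\<close>

definition Qp_dist :: "nat \<Rightarrow> padic \<Rightarrow> padic \<Rightarrow> real" where
  "Qp_dist p x y =
     (if x \<in> carrier (Qp p) \<and> y \<in> carrier (Qp p) then Qp_norm p (x \<ominus>\<^bsub>Qp p\<^esub> y) else 0)"

definition Qp_topology :: "nat \<Rightarrow> padic topology" where
  "Qp_topology p = Metric_space.mtopology (carrier (Qp p)) (Qp_dist p)"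

lemma padic_Cauchy_const: "padic_Cauchy p (\<lambda>n. x)"
  by (auto simp: padic_Cauchy_def)

context
  fixes p :: nat
  assumes p: "prime p"
begin

lemma padic_Cauchy_add:
  assumes "padic_Cauchy p X" "padic_Cauchy p Y"
  shows "padic_Cauchy p (\<lambda>n. X n + Y n)"
  unfolding padic_Cauchy_def
proof (intro allI impI)
  fix e :: real assume "e > 0"
  then obtain M N where M: "\<forall>m\<ge>M. \<forall>n\<ge>M. padic_abs p (X m - X n) < e"
    and N: "\<forall>m\<ge>N. \<forall>n\<ge>N. padic_abs p (Y m - Y n) < e"
    using assms unfolding padic_Cauchy_def by meson
  have "padic_abs p (X m + Y m - (X n + Y n)) < e" if "m \<ge> max M N" "n \<ge> max M N" for m n
  proof -
    have "padic_abs p (X m - X n) < e" "padic_abs p (Y m - Y n) < e" using M N that by auto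
    then show ?thesis using padic_abs_add[OF p, of "X m - X n" "Y m - Y n"]
      by (simp add: algebra_simps)
  qed
  then show "\<exists>N. \<forall>m\<ge>N. \<forall>n\<ge>N. padic_abs p (X m + Y m - (X n + Y n)) < e" by blast
qed

lemma padic_Cauchy_uminus: "padic_Cauchy p X \<Longrightarrow> padic_Cauchy p (\<lambda>n. - X n)"
  unfolding padic_Cauchy_def
  by (metis (no_types, lifting) minus_diff_commute minus_minus padic_abs_minus padic_abs_minus_commute)

lemma padic_Cauchy_convergent:
  assumes "padic_Cauchy p X"
  shows "convergent (\<lambda>n. padic_abs p (X n))"
proof -
  have "Cauchy (\<lambda>n. padic_abs p (X n))"
    unfolding Cauchy_def dist_real_def
    using assms padic_abs_diff_abs[OF p] unfolding padic_Cauchy_def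
    by (meson le_less_trans)
  then show ?thesis by (simp add: Cauchy_convergent_iff)
qed

lemma padic_Cauchy_bounded:
  assumes "padic_Cauchy p X"
  obtains B where "B > 0" "\<And>n. padic_abs p (X n) \<le> B"
proof -
  have "Bseq (\<lambda>n. padic_abs p (X n))"
    using padic_Cauchy_convergent[OF assms] by (rule convergent_imp_Bseq)
  then show ?thesis using that unfolding Bseq_def by auto
qed

lemma padic_Cauchy_mult:
  assumes "padic_Cauchy p X" "padic_Cauchy p Y"
  shows "padic_Cauchy p (\<lambda>n. X n * Y n)"
  unfolding padic_Cauchy_def
proof (intro allI impI)
  fix e :: real assume e: "e > 0"
  obtain A where A: "A > 0" "\<And>n. padic_abs p (X n) \<le> A"
    using padic_Cauchy_bounded[OF assms(1)] by blast
  obtain B where B: "B > 0" "\<And>n. padic_abs p (Y n) \<le> B"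
    using padic_Cauchy_bounded[OF assms(2)] by blast
  have eB: "e / B > 0" "e / A > 0" using e A B by auto
  obtain M N where M: "\<forall>m\<ge>M. \<forall>n\<ge>M. padic_abs p (X m - X n) < e / B"
    and N: "\<forall>m\<ge>N. \<forall>n\<ge>N. padic_abs p (Y m - Y n) < e / A"
    using assms eB unfolding padic_Cauchy_def by meson
  have "padic_abs p (X m * Y m - X n * Y n) < e" if "m \<ge> max M N" "n \<ge> max M N" for m n
  proof -
    have "padic_abs p (X m - X n) < e / B" "padic_abs p (Y m - Y n) < e / A" using M N that by auto
    then have 1: "padic_abs p (X m - X n) * B < e" "A * padic_abs p (Y m - Y n) < e"
      using A B by (auto simp: field_simps)
    have 2: "padic_abs p ((X m - X n) * Y m) \<le> padic_abs p (X m - X n) * B"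
      unfolding padic_abs_mult[OF p] using B by (intro mult_left_mono) auto
    have 3: "padic_abs p (X n * (Y m - Y n)) \<le> A * padic_abs p (Y m - Y n)"
      unfolding padic_abs_mult[OF p] using A by (intro mult_right_mono) auto
    have "X m * Y m - X n * Y n = (X m - X n) * Y m + X n * (Y m - Y n)"
      by (simp add: algebra_simps)
    then show ?thesis using padic_abs_add[OF p, of "(X m - X n) * Y m" "X n * (Y m - Y n)"] 1 2 3
      by (simp only:)
  qed
  then show "\<exists>N. \<forall>m\<ge>N. \<forall>n\<ge>N. padic_abs p (X m * Y m - X n * Y n) < e" by blast
qed

lemma padic_null_Cauchy: "X \<in> padic_null p \<Longrightarrow> padic_Cauchy p X"
  unfolding padic_Cauchy_def
proof (intro allI impI)
  fix e :: real assume "e > 0" and "X \<in> padic_null p"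
  then obtain N where N: "\<And>n. n \<ge> N \<Longrightarrow> padic_abs p (X n) < e"
    unfolding padic_null_def using LIMSEQ_D[of "\<lambda>n. padic_abs p (X n)" 0 e] by auto
  have "padic_abs p (X m - X n) < e" if "m \<ge> N" "n \<ge> N" for m n
    using padic_abs_diff[OF p, of "X m" "X n"] N[OF that(1)] N[OF that(2)] by simp
  then show "\<exists>N. \<forall>m\<ge>N. \<forall>n\<ge>N. padic_abs p (X m - X n) < e" by blast
qed

lemma padic_null_add:
  assumes "X \<in> padic_null p" "Y \<in> padic_null p"
  shows "(\<lambda>n. X n + Y n) \<in> padic_null p"
proof -
  have "(\<lambda>n. padic_abs p (X n) + padic_abs p (Y n)) \<longlonglongrightarrow> 0 + 0"
    using assms unfolding padic_null_def by (intro tendsto_add) auto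
  then have "(\<lambda>n. padic_abs p (X n) + padic_abs p (Y n)) \<longlonglongrightarrow> 0" by simp
  then have "(\<lambda>n. padic_abs p (X n + Y n)) \<longlonglongrightarrow> 0"
    by (rule Lim_null_comparison[rotated]) (simp add: padic_abs_add_le[OF p])
  then show ?thesis by (simp add: padic_null_def)
qed

lemma padic_null_uminus: "X \<in> padic_null p \<Longrightarrow> (\<lambda>n. - X n) \<in> padic_null p"
  by (simp add: padic_null_def)

lemma padic_null_mult:
  assumes "X \<in> padic_null p" "padic_Cauchy p Y"
  shows "(\<lambda>n. X n * Y n) \<in> padic_null p"
proof -
  obtain L where "(\<lambda>n. padic_abs p (Y n)) \<longlonglongrightarrow> L"
    using padic_Cauchy_convergent[OF assms(2)] by (auto simp: convergent_def)
  then have "(\<lambda>n. padic_abs p (X n) * padic_abs p (Y n)) \<longlonglongrightarrow> 0 * L"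
    using assms(1) unfolding padic_null_def by (intro tendsto_mult) auto
  then show ?thesis by (simp add: padic_null_def padic_abs_mult[OF p])
qed

lemma padic_Cauchy_ring_cring: "cring (padic_Cauchy_ring p)"
proof (intro cringI abelian_groupI comm_monoidI)
  fix X assume "X \<in> carrier (padic_Cauchy_ring p)"
  then show "\<exists>Y\<in>carrier (padic_Cauchy_ring p).
               Y \<oplus>\<^bsub>padic_Cauchy_ring p\<^esub> X = \<zero>\<^bsub>padic_Cauchy_ring p\<^esub>"
    by (intro bexI[of _ "\<lambda>n. - X n"])
       (auto simp: padic_Cauchy_ring_def padic_Cauchy_uminus)
qed (auto simp: padic_Cauchy_ring_def padic_Cauchy_add padic_Cauchy_mult padic_Cauchy_const
       algebra_simps)

lemma padic_null_ideal: "ideal (padic_null p) (padic_Cauchy_ring p)"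
proof (rule idealI)
  interpret R: cring "padic_Cauchy_ring p" by (rule padic_Cauchy_ring_cring)
  show "ring (padic_Cauchy_ring p)" by (rule R.ring_axioms)
  show "subgroup (padic_null p) (add_monoid (padic_Cauchy_ring p))"
  proof (rule R.add.subgroupI)
    show "padic_null p \<subseteq> carrier (padic_Cauchy_ring p)"
      by (auto simp: padic_Cauchy_ring_def padic_null_Cauchy)
    have "(\<lambda>n. 0) \<in> padic_null p" by (simp add: padic_null_def)
    then show "padic_null p \<noteq> {}" by blast
    fix X assume X: "X \<in> padic_null p"
    have "\<ominus>\<^bsub>padic_Cauchy_ring p\<^esub> X = (\<lambda>n. - X n)"
      using X by (intro R.minus_equality)
        (auto simp: padic_Cauchy_ring_def padic_null_Cauchy padic_null_uminus)
    then show "\<ominus>\<^bsub>padic_Cauchy_ring p\<^esub> X \<in> padic_null p"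
      using padic_null_uminus[OF X] by simp
    fix Y assume "Y \<in> padic_null p"
    then show "X \<oplus>\<^bsub>padic_Cauchy_ring p\<^esub> Y \<in> padic_null p"
      using padic_null_add[OF X] by (simp add: padic_Cauchy_ring_def)
  qed
  fix X Y assume "X \<in> padic_null p" "Y \<in> carrier (padic_Cauchy_ring p)"
  then show "Y \<otimes>\<^bsub>padic_Cauchy_ring p\<^esub> X \<in> padic_null p"
    "X \<otimes>\<^bsub>padic_Cauchy_ring p\<^esub> Y \<in> padic_null p"
    using padic_null_mult by (simp_all add: padic_Cauchy_ring_def mult.commute)
qed

lemma Qp_cring: "cring (Qp p)"
  unfolding Qp_def using ideal.quotient_is_cring[OF padic_null_ideal padic_Cauchy_ring_cring] .

abbreviation (input) Qcls :: "(nat \<Rightarrow> rat) \<Rightarrow> padic" where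
  "Qcls X \<equiv> padic_null p +>\<^bsub>padic_Cauchy_ring p\<^esub> X"

lemma Qp_carrierE:
  assumes "x \<in> carrier (Qp p)"
  obtains X where "padic_Cauchy p X" "x = Qcls X"
  using assms unfolding Qp_def FactRing_def A_RCOSETS_def' by (auto simp: padic_Cauchy_ring_def)

lemma Qp_cls_carrier: "padic_Cauchy p X \<Longrightarrow> Qcls X \<in> carrier (Qp p)"
  unfolding Qp_def FactRing_def A_RCOSETS_def' by (auto simp: padic_Cauchy_ring_def)

lemma Qp_add_cls:
  assumes "padic_Cauchy p X" "padic_Cauchy p Y"
  shows "Qcls X \<oplus>\<^bsub>Qp p\<^esub> Qcls Y = Qcls (\<lambda>n. X n + Y n)"
  using ideal.a_rcos_sum[OF padic_null_ideal, of X Y] assms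
  by (simp add: Qp_def FactRing_def padic_Cauchy_ring_def)

lemma Qp_mult_cls:
  assumes "padic_Cauchy p X" "padic_Cauchy p Y"
  shows "Qcls X \<otimes>\<^bsub>Qp p\<^esub> Qcls Y = Qcls (\<lambda>n. X n * Y n)"
  using ideal.rcoset_mult_add[OF padic_null_ideal, of X Y] assms
  by (simp add: Qp_def FactRing_def padic_Cauchy_ring_def)

lemma Qp_one_cls: "\<one>\<^bsub>Qp p\<^esub> = Qcls (\<lambda>n. 1)"
  by (simp add: Qp_def FactRing_def padic_Cauchy_ring_def)

lemma Qp_zero_cls: "\<zero>\<^bsub>Qp p\<^esub> = Qcls (\<lambda>n. 0)"
proof -
  have "Qcls (\<lambda>n. 0) = padic_null p"
    by (auto simp: a_r_coset_def' padic_Cauchy_ring_def)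
  then show ?thesis by (simp add: Qp_def FactRing_def)
qed

lemma Qp_uminus_cls:
  assumes "padic_Cauchy p X"
  shows "\<ominus>\<^bsub>Qp p\<^esub> Qcls X = Qcls (\<lambda>n. - X n)"
proof -
  interpret Q: cring "Qp p" by (rule Qp_cring)
  show ?thesis using assms
    by (intro Q.minus_equality)
       (simp_all add: Qp_cls_carrier padic_Cauchy_uminus Qp_add_cls Qp_zero_cls)
qed

lemma Qp_minus_cls:
  assumes "padic_Cauchy p X" "padic_Cauchy p Y"
  shows "Qcls X \<ominus>\<^bsub>Qp p\<^esub> Qcls Y = Qcls (\<lambda>n. X n - Y n)"
  using assms by (simp add: a_minus_def Qp_uminus_cls Qp_add_cls padic_Cauchy_uminus)

lemma mem_Qp_cls: "Y \<in> Qcls X \<longleftrightarrow> (\<lambda>n. Y n - X n) \<in> padic_null p"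
proof
  show "(\<lambda>n. Y n - X n) \<in> padic_null p" if "Y \<in> Qcls X"
    using that by (auto simp: a_r_coset_def' padic_Cauchy_ring_def)
  assume "(\<lambda>n. Y n - X n) \<in> padic_null p"
  then show "Y \<in> Qcls X"
    by (auto simp: a_r_coset_def' padic_Cauchy_ring_def intro!: bexI[of _ "\<lambda>n. Y n - X n"])
qed

lemma Qp_cls_self: "X \<in> Qcls X"
  unfolding mem_Qp_cls by (simp add: padic_null_def)

lemma Qp_cls_eqI:
  assumes "(\<lambda>n. X n - Y n) \<in> padic_null p"
  shows "Qcls X = Qcls Y"
proof (rule Set.set_eqI)
  fix Z
  have "(\<lambda>n. Z n - Y n) \<in> padic_null p" if "(\<lambda>n. Z n - X n) \<in> padic_null p"
    using padic_null_add[OF that assms] by simp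
  moreover have "(\<lambda>n. Z n - X n) \<in> padic_null p" if "(\<lambda>n. Z n - Y n) \<in> padic_null p"
    using padic_null_add[OF that padic_null_uminus[OF assms]] by simp
  ultimately show "Z \<in> Qcls X \<longleftrightarrow> Z \<in> Qcls Y" unfolding mem_Qp_cls by blast
qed

lemma Qp_norm_tendsto:
  assumes "padic_Cauchy p X"
  shows "(\<lambda>n. padic_abs p (X n)) \<longlonglongrightarrow> Qp_norm p (Qcls X)"
proof -
  obtain L where L: "(\<lambda>n. padic_abs p (X n)) \<longlonglongrightarrow> L"
    using padic_Cauchy_convergent[OF assms] by (auto simp: convergent_def)
  have YL: "(\<lambda>n. padic_abs p (Y n)) \<longlonglongrightarrow> L" if "Y \<in> Qcls X" for Y
  proof -
    have n: "(\<lambda>n. padic_abs p (Y n - X n)) \<longlonglongrightarrow> 0"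
      using that unfolding mem_Qp_cls by (simp add: padic_null_def)
    have "(\<lambda>n. padic_abs p (Y n) - padic_abs p (X n)) \<longlonglongrightarrow> 0"
      by (rule Lim_null_comparison[OF _ n]) (simp add: padic_abs_diff_abs[OF p])
    from tendsto_add[OF this L] show ?thesis by simp
  qed
  have "Qp_norm p (Qcls X) = L"
    unfolding Qp_norm_def using Qp_cls_self[of X] YL L by (intro the_equality) (auto intro: LIMSEQ_unique)
  then show ?thesis using L by simp
qed

lemma Qp_norm_nonneg: "x \<in> carrier (Qp p) \<Longrightarrow> Qp_norm p x \<ge> 0"
  by (elim Qp_carrierE) (auto intro: LIMSEQ_le_const[OF Qp_norm_tendsto])

lemma Qp_norm_eq_0_iff:
  assumes "x \<in> carrier (Qp p)"
  shows "Qp_norm p x = 0 \<longleftrightarrow> x = \<zero>\<^bsub>Qp p\<^esub>"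
proof -
  obtain X where X: "padic_Cauchy p X" "x = Qcls X" using assms Qp_carrierE by blast
  have "Qp_norm p x = 0 \<longleftrightarrow> X \<in> padic_null p"
    using Qp_norm_tendsto[OF X(1)] X(2) by (auto simp: padic_null_def intro: LIMSEQ_unique)
  also have "\<dots> \<longleftrightarrow> x = \<zero>\<^bsub>Qp p\<^esub>"
  proof
    assume "X \<in> padic_null p"
    then have "Qcls X = Qcls (\<lambda>n. 0)" by (intro Qp_cls_eqI) simp
    then show "x = \<zero>\<^bsub>Qp p\<^esub>" by (simp add: X Qp_zero_cls)
  next
    assume "x = \<zero>\<^bsub>Qp p\<^esub>"
    moreover have "X \<in> x" using X Qp_cls_self by simp
    ultimately show "X \<in> padic_null p" by (simp add: Qp_zero_cls mem_Qp_cls)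
  qed
  finally show ?thesis .
qed

lemma Qp_norm_add:
  assumes "x \<in> carrier (Qp p)" "y \<in> carrier (Qp p)"
  shows "Qp_norm p (x \<oplus>\<^bsub>Qp p\<^esub> y) \<le> max (Qp_norm p x) (Qp_norm p y)"
proof -
  obtain X Y where X: "padic_Cauchy p X" "x = Qcls X" and Y: "padic_Cauchy p Y" "y = Qcls Y"
    using assms Qp_carrierE by metis
  show ?thesis unfolding X(2) Y(2) Qp_add_cls[OF X(1) Y(1)]
    by (rule LIMSEQ_le[OF Qp_norm_tendsto[OF padic_Cauchy_add[OF X(1) Y(1)]]
          tendsto_max[OF Qp_norm_tendsto[OF X(1)] Qp_norm_tendsto[OF Y(1)]]])
       (auto intro: padic_abs_add[OF p])
qed

lemma Qp_norm_mult:
  assumes "x \<in> carrier (Qp p)" "y \<in> carrier (Qp p)"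
  shows "Qp_norm p (x \<otimes>\<^bsub>Qp p\<^esub> y) = Qp_norm p x * Qp_norm p y"
proof -
  obtain X Y where X: "padic_Cauchy p X" "x = Qcls X" and Y: "padic_Cauchy p Y" "y = Qcls Y"
    using assms Qp_carrierE by metis
  have "(\<lambda>n. padic_abs p (X n * Y n)) \<longlonglongrightarrow> Qp_norm p (Qcls X) * Qp_norm p (Qcls Y)"
    unfolding padic_abs_mult[OF p] by (intro tendsto_mult Qp_norm_tendsto X Y)
  then show ?thesis unfolding X(2) Y(2) Qp_mult_cls[OF X(1) Y(1)]
    using LIMSEQ_unique Qp_norm_tendsto[OF padic_Cauchy_mult[OF X(1) Y(1)]] by blast
qed

lemma Qp_norm_uminus:
  assumes "x \<in> carrier (Qp p)"
  shows "Qp_norm p (\<ominus>\<^bsub>Qp p\<^esub> x) = Qp_norm p x"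
proof -
  obtain X where X: "padic_Cauchy p X" "x = Qcls X" using assms Qp_carrierE by metis
  show ?thesis unfolding X(2) Qp_uminus_cls[OF X(1)]
    using LIMSEQ_unique Qp_norm_tendsto[OF padic_Cauchy_uminus[OF X(1)]] Qp_norm_tendsto[OF X(1)]
    by (simp only: padic_abs_minus) blast
qed

lemma Qp_norm_minus:
  assumes "x \<in> carrier (Qp p)" "y \<in> carrier (Qp p)"
  shows "Qp_norm p (x \<ominus>\<^bsub>Qp p\<^esub> y) \<le> max (Qp_norm p x) (Qp_norm p y)"
proof -
  interpret Q: cring "Qp p" by (rule Qp_cring)
  show ?thesis using Qp_norm_add[of x "\<ominus>\<^bsub>Qp p\<^esub> y"] assms
    by (simp add: a_minus_def Qp_norm_uminus)
qed

lemma Qp_of_rat_carrier [simp]: "Qp_of_rat p x \<in> carrier (Qp p)"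
  by (simp add: Qp_of_rat_def Qp_cls_carrier padic_Cauchy_const)

lemma Qp_of_rat_add: "Qp_of_rat p (x + y) = Qp_of_rat p x \<oplus>\<^bsub>Qp p\<^esub> Qp_of_rat p y"
  by (simp add: Qp_of_rat_def Qp_add_cls padic_Cauchy_const)

lemma Qp_of_rat_mult: "Qp_of_rat p (x * y) = Qp_of_rat p x \<otimes>\<^bsub>Qp p\<^esub> Qp_of_rat p y"
  by (simp add: Qp_of_rat_def Qp_mult_cls padic_Cauchy_const)

lemma Qp_of_rat_uminus: "Qp_of_rat p (- x) = \<ominus>\<^bsub>Qp p\<^esub> Qp_of_rat p x"
  by (simp add: Qp_of_rat_def Qp_uminus_cls padic_Cauchy_const)

lemma Qp_of_rat_diff: "Qp_of_rat p (x - y) = Qp_of_rat p x \<ominus>\<^bsub>Qp p\<^esub> Qp_of_rat p y"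
  by (simp add: Qp_of_rat_def Qp_minus_cls padic_Cauchy_const)

lemma Qp_of_rat_0: "Qp_of_rat p 0 = \<zero>\<^bsub>Qp p\<^esub>"
  by (simp add: Qp_of_rat_def Qp_zero_cls)

lemma Qp_of_rat_1: "Qp_of_rat p 1 = \<one>\<^bsub>Qp p\<^esub>"
  by (simp add: Qp_of_rat_def Qp_one_cls)

lemma Qp_norm_of_rat [simp]: "Qp_norm p (Qp_of_rat p x) = padic_abs p x"
  using Qp_norm_tendsto[OF padic_Cauchy_const[of p x]]
  by (simp add: Qp_of_rat_def LIMSEQ_const_iff)

lemma Qp_dense_rat:
  assumes "x \<in> carrier (Qp p)" "e > 0"
  obtains r where "Qp_norm p (x \<ominus>\<^bsub>Qp p\<^esub> Qp_of_rat p r) \<le> e"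
proof -
  obtain X where X: "padic_Cauchy p X" "x = Qcls X" using assms Qp_carrierE by metis
  obtain N where N: "\<And>m n. m \<ge> N \<Longrightarrow> n \<ge> N \<Longrightarrow> padic_abs p (X m - X n) < e"
    using X(1) assms(2) unfolding padic_Cauchy_def by meson
  have C: "padic_Cauchy p (\<lambda>n. X n - X N)"
    using padic_Cauchy_add[OF X(1) padic_Cauchy_const[of p "- X N"]] by simp
  have "Qp_norm p (Qcls (\<lambda>n. X n - X N)) \<le> e"
    using N by (intro LIMSEQ_le_const2[OF Qp_norm_tendsto[OF C]] exI[of _ N]) (auto intro: less_imp_le)
  then show ?thesis using that[of "X N"]
    by (simp add: X Qp_of_rat_def Qp_minus_cls padic_Cauchy_const)
qed

lemma Qp_Metric_space: "Metric_space (carrier (Qp p)) (Qp_dist p)"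
proof
  interpret Q: cring "Qp p" by (rule Qp_cring)
  show nonneg: "0 \<le> Qp_dist p x y" for x y
    by (simp add: Qp_dist_def Qp_norm_nonneg)
  show "Qp_dist p x y = Qp_dist p y x" for x y
  proof (cases "x \<in> carrier (Qp p) \<and> y \<in> carrier (Qp p)")
    case True
    then have "x \<ominus>\<^bsub>Qp p\<^esub> y = \<ominus>\<^bsub>Qp p\<^esub> (y \<ominus>\<^bsub>Qp p\<^esub> x)"
      by (simp add: a_minus_def Q.minus_add Q.a_comm)
    then show ?thesis using True by (simp add: Qp_dist_def Qp_norm_uminus)
  qed (auto simp: Qp_dist_def)
  show "Qp_dist p x y = 0 \<longleftrightarrow> x = y" if "x \<in> carrier (Qp p)" "y \<in> carrier (Qp p)" for x y
  proof -
    have "x \<ominus>\<^bsub>Qp p\<^esub> y = \<zero>\<^bsub>Qp p\<^esub> \<longleftrightarrow> x = y"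
      using that by (metis a_minus_def Q.add.inv_closed Q.minus_equality Q.minus_minus Q.r_neg)
    then show ?thesis using that by (simp add: Qp_dist_def Qp_norm_eq_0_iff)
  qed
  show "Qp_dist p x z \<le> Qp_dist p x y + Qp_dist p y z"
    if "x \<in> carrier (Qp p)" "y \<in> carrier (Qp p)" "z \<in> carrier (Qp p)" for x y z
  proof -
    have "x \<ominus>\<^bsub>Qp p\<^esub> z = (x \<ominus>\<^bsub>Qp p\<^esub> y) \<oplus>\<^bsub>Qp p\<^esub> (y \<ominus>\<^bsub>Qp p\<^esub> z)"
      using that by (simp add: a_minus_def Q.a_assoc Q.r_neg1)
    then show ?thesis using that nonneg[of x y] nonneg[of y z]
        Qp_norm_add[of "x \<ominus>\<^bsub>Qp p\<^esub> y" "y \<ominus>\<^bsub>Qp p\<^esub> z"]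
      by (simp add: Qp_dist_def)
  qed
qed

end

context
  fixes p :: nat
  assumes p: "prime p"
begin

lemma Zp_add: "x \<in> Zp p \<Longrightarrow> y \<in> Zp p \<Longrightarrow> x \<oplus>\<^bsub>Qp p\<^esub> y \<in> Zp p"
  using Qp_norm_add[OF p, of x y] cring.cring_simprules(1)[OF Qp_cring[OF p], of x y]
  by (auto simp: Zp_def)

lemma Zp_mult: "x \<in> Zp p \<Longrightarrow> y \<in> Zp p \<Longrightarrow> x \<otimes>\<^bsub>Qp p\<^esub> y \<in> Zp p"
  using Qp_norm_mult[OF p, of x y] cring.cring_simprules(5)[OF Qp_cring[OF p], of x y]
    mult_le_one[of "Qp_norm p x" "Qp_norm p y"] Qp_norm_nonneg[OF p, of y]
  by (auto simp: Zp_def)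

lemma Zp_uminus: "x \<in> Zp p \<Longrightarrow> \<ominus>\<^bsub>Qp p\<^esub> x \<in> Zp p"
  using Qp_norm_uminus[OF p, of x] cring.cring_simprules(3)[OF Qp_cring[OF p], of x]
  by (auto simp: Zp_def)

lemma Zp_minus: "x \<in> Zp p \<Longrightarrow> y \<in> Zp p \<Longrightarrow> x \<ominus>\<^bsub>Qp p\<^esub> y \<in> Zp p"
  by (simp add: a_minus_def Zp_add Zp_uminus)

lemma Qp_of_rat_in_Zp_iff: "Qp_of_rat p x \<in> Zp p \<longleftrightarrow> padic_abs p x \<le> 1"
  by (simp add: Zp_def Qp_of_rat_carrier[OF p] Qp_norm_of_rat[OF p])

lemma Zp_zero: "\<zero>\<^bsub>Qp p\<^esub> \<in> Zp p"
  unfolding Qp_of_rat_0[OF p, symmetric] Qp_of_rat_in_Zp_iff by simp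

lemma Zp_one: "\<one>\<^bsub>Qp p\<^esub> \<in> Zp p"
  unfolding Qp_of_rat_1[OF p, symmetric] Qp_of_rat_in_Zp_iff by (simp add: padic_abs_1[OF p])

lemma Zp_carrier: "x \<in> Zp p \<Longrightarrow> x \<in> carrier (Qp p)"
  by (simp add: Zp_def)

end

text \<open>The restricted product of the reals and all \<open>Q\<^sub>p\<close> with respect to the \<open>Z\<^sub>p\<close>: a real number together
  with a family indexed by the primes, extensional outside the primes.\<close>

typedef adele =
  "{(x :: real, a). a \<in> (\<Pi>\<^sub>E p\<in>{p. prime p}. carrier (Qp p)) \<and> finite {p. prime p \<and> a p \<notin> Zp p}}"
  morphisms adele_coords Abs_adele
proof -
  have "{p. prime p \<and> restrict (\<lambda>p. \<zero>\<^bsub>Qp p\<^esub>) {p. prime p} p \<notin> Zp p} = {}"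
    by (auto simp: Zp_zero)
  then show ?thesis
    by (intro exI[of _ "(0, restrict (\<lambda>p. \<zero>\<^bsub>Qp p\<^esub>) {p. prime p})"])
       (auto intro: Zp_carrier[OF _ Zp_zero])
qed

setup_lifting type_definition_adele

lemma adele_coordsI:
  assumes "\<And>p. prime p \<Longrightarrow> f p \<in> carrier (Qp p)"
    and "finite {p. prime p \<and> f p \<notin> Zp p}"
  shows "(x, \<lambda>p\<in>{p. prime p}. f p) \<in>
    {(x :: real, a). a \<in> (\<Pi>\<^sub>E p\<in>{p. prime p}. carrier (Qp p)) \<and> finite {p. prime p \<and> a p \<notin> Zp p}}"
proof -
  have "{p. prime p \<and> restrict f {p. prime p} p \<notin> Zp p} = {p. prime p \<and> f p \<notin> Zp p}"
    by auto
  then show ?thesis using assms by simp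
qed

lemma finite_nonintegral_unop:
  assumes "finite {p. prime p \<and> a p \<notin> Zp p}"
    and "\<And>p. prime p \<Longrightarrow> a p \<in> Zp p \<Longrightarrow> f p \<in> Zp p"
  shows "finite {p. prime p \<and> f p \<notin> Zp p}"
  using assms(1) by (rule rev_finite_subset) (use assms(2) in blast)

lemma finite_nonintegral_binop:
  assumes "finite {p. prime p \<and> a p \<notin> Zp p}" "finite {p. prime p \<and> b p \<notin> Zp p}"
    and "\<And>p. prime p \<Longrightarrow> a p \<in> Zp p \<Longrightarrow> b p \<in> Zp p \<Longrightarrow> f p \<in> Zp p"
  shows "finite {p. prime p \<and> f p \<notin> Zp p}"
  using finite_UnI[OF assms(1,2)] by (rule rev_finite_subset) (use assms(3) in blast)

lift_definition adele_real :: "adele \<Rightarrow> real" is fst .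

lift_definition adele_padic :: "adele \<Rightarrow> nat \<Rightarrow> padic" is snd .

lift_definition adele_of_rat :: "rat \<Rightarrow> adele" is
  "\<lambda>q. (of_rat q, \<lambda>p\<in>{p. prime p}. Qp_of_rat p q)"
proof (rule adele_coordsI)
  fix q
  have "{p. prime p \<and> Qp_of_rat p q \<notin> Zp p} = {p. prime p \<and> \<not> padic_abs p q \<le> 1}"
    by (intro Collect_cong conj_cong refl) (simp add: Qp_of_rat_in_Zp_iff)
  then show "finite {p. prime p \<and> Qp_of_rat p q \<notin> Zp p}"
    using finite_padic_abs_gt_1 by simp
qed (rule Qp_of_rat_carrier)

lemma adele_padic_PiE: "adele_padic x \<in> (\<Pi>\<^sub>E p\<in>{p. prime p}. carrier (Qp p))"
  and finite_adele_nonintegral: "finite {p. prime p \<and> adele_padic x p \<notin> Zp p}"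
  using adele_coords[of x] unfolding adele_padic.rep_eq mem_Collect_eq case_prod_beta
  by blast+

lemma adele_padic_carrier: "prime p \<Longrightarrow> adele_padic x p \<in> carrier (Qp p)"
  using adele_padic_PiE[of x] by (rule PiE_mem) simp

lemma adele_eqI:
  assumes "adele_real x = adele_real y" "\<And>p. prime p \<Longrightarrow> adele_padic x p = adele_padic y p"
  shows "x = y"
proof -
  have "adele_padic x = adele_padic y"
    by (rule PiE_ext[OF adele_padic_PiE adele_padic_PiE]) (simp add: assms)
  with assms(1) have "adele_coords x = adele_coords y"
    by (intro prod_eqI) (simp_all add: adele_real.rep_eq adele_padic.rep_eq)
  then show ?thesis by (simp only: adele_coords_inject)
qed

instantiation adele :: comm_ring_1
begin

lift_definition zero_adele :: adele is "(0, \<lambda>p\<in>{p. prime p}. \<zero>\<^bsub>Qp p\<^esub>)"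
proof (rule adele_coordsI)
  have "{p. prime p \<and> \<zero>\<^bsub>Qp p\<^esub> \<notin> Zp p} = {}" using Zp_zero by blast
  then show "finite {p. prime p \<and> \<zero>\<^bsub>Qp p\<^esub> \<notin> Zp p}"
    by (simp only: finite.emptyI)
qed (rule Zp_carrier[OF _ Zp_zero])

lift_definition one_adele :: adele is "(1, \<lambda>p\<in>{p. prime p}. \<one>\<^bsub>Qp p\<^esub>)"
proof (rule adele_coordsI)
  have "{p. prime p \<and> \<one>\<^bsub>Qp p\<^esub> \<notin> Zp p} = {}" using Zp_one by blast
  then show "finite {p. prime p \<and> \<one>\<^bsub>Qp p\<^esub> \<notin> Zp p}"
    by (simp only: finite.emptyI)
qed (rule Zp_carrier[OF _ Zp_one])

lift_definition plus_adele :: "adele \<Rightarrow> adele \<Rightarrow> adele" is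
  "\<lambda>(x, a) (y, b). (x + y, \<lambda>p\<in>{p. prime p}. a p \<oplus>\<^bsub>Qp p\<^esub> b p)"
  subgoal premises prems for u v
  proof -
    obtain x a y b where uv: "u = (x, a)" "v = (y, b)" by (metis surj_pair)
    have c: "prime p \<Longrightarrow> a p \<in> carrier (Qp p) \<and> b p \<in> carrier (Qp p)" for p
      using prems by (auto simp: uv)
    have f: "finite {p. prime p \<and> a p \<notin> Zp p}" "finite {p. prime p \<and> b p \<notin> Zp p}"
      using prems by (auto simp: uv)
    show ?thesis unfolding uv split_conv
      by (intro adele_coordsI finite_nonintegral_binop[OF f])
         (simp_all add: c cring.cring_simprules(1)[OF Qp_cring] Zp_add)
  qed
  done

lift_definition times_adele :: "adele \<Rightarrow> adele \<Rightarrow> adele" is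
  "\<lambda>(x, a) (y, b). (x * y, \<lambda>p\<in>{p. prime p}. a p \<otimes>\<^bsub>Qp p\<^esub> b p)"
  subgoal premises prems for u v
  proof -
    obtain x a y b where uv: "u = (x, a)" "v = (y, b)" by (metis surj_pair)
    have c: "prime p \<Longrightarrow> a p \<in> carrier (Qp p) \<and> b p \<in> carrier (Qp p)" for p
      using prems by (auto simp: uv)
    have f: "finite {p. prime p \<and> a p \<notin> Zp p}" "finite {p. prime p \<and> b p \<notin> Zp p}"
      using prems by (auto simp: uv)
    show ?thesis unfolding uv split_conv
      by (intro adele_coordsI finite_nonintegral_binop[OF f])
         (simp_all add: c cring.cring_simprules(5)[OF Qp_cring] Zp_mult)
  qed
  done

lift_definition uminus_adele :: "adele \<Rightarrow> adele" is
  "\<lambda>(x, a). (- x, \<lambda>p\<in>{p. prime p}. \<ominus>\<^bsub>Qp p\<^esub> a p)"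
  subgoal premises prems for u
  proof -
    obtain x a where u: "u = (x, a)" by (metis surj_pair)
    have c: "prime p \<Longrightarrow> a p \<in> carrier (Qp p)" for p
      using prems by (auto simp: u)
    have f: "finite {p. prime p \<and> a p \<notin> Zp p}" using prems by (auto simp: u)
    show ?thesis unfolding u split_conv
      by (intro adele_coordsI finite_nonintegral_unop[OF f])
         (simp_all add: c cring.cring_simprules(3)[OF Qp_cring] Zp_uminus)
  qed
  done

definition minus_adele :: "adele \<Rightarrow> adele \<Rightarrow> adele" where
  "minus_adele x y = x + (- y)"

lemma adele_real_ops:
  "adele_real 0 = 0" "adele_real 1 = 1" "adele_real (x + y) = adele_real x + adele_real y"
  "adele_real (x * y) = adele_real x * adele_real y" "adele_real (- x) = - adele_real x"
  by (simp_all add: adele_real.rep_eq zero_adele.rep_eq one_adele.rep_eq plus_adele.rep_eq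
        times_adele.rep_eq uminus_adele.rep_eq case_prod_beta)

lemma adele_padic_ops:
  assumes "prime p"
  shows "adele_padic 0 p = \<zero>\<^bsub>Qp p\<^esub>" "adele_padic 1 p = \<one>\<^bsub>Qp p\<^esub>"
    "adele_padic (x + y) p = adele_padic x p \<oplus>\<^bsub>Qp p\<^esub> adele_padic y p"
    "adele_padic (x * y) p = adele_padic x p \<otimes>\<^bsub>Qp p\<^esub> adele_padic y p"
    "adele_padic (- x) p = \<ominus>\<^bsub>Qp p\<^esub> adele_padic x p"
  using assms
  by (simp_all add: adele_padic.rep_eq zero_adele.rep_eq one_adele.rep_eq plus_adele.rep_eq
        times_adele.rep_eq uminus_adele.rep_eq case_prod_beta)

instance
proof
  fix x y z :: adele
  note simps = adele_real_ops adele_padic_ops cring.cring_simprules[OF Qp_cring] adele_padic_carrier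
  show "x + y + z = x + (y + z)" by (rule adele_eqI) (simp_all add: simps)
  show "x + y = y + x" by (rule adele_eqI) (simp_all add: simps)
  show "0 + x = x"
    by (rule adele_eqI)
       (simp_all add: adele_real_ops adele_padic_ops adele_padic_carrier
          cring.cring_simprules(8)[OF Qp_cring])
  show "- x + x = 0" by (rule adele_eqI) (simp_all add: simps)
  show "x - y = x + - y" by (rule minus_adele_def)
  show "x * y * z = x * (y * z)" by (rule adele_eqI) (simp_all add: simps)
  show "x * y = y * x" by (rule adele_eqI) (simp_all add: simps)
  show "1 * x = x"
    by (rule adele_eqI)
       (simp_all add: adele_real_ops adele_padic_ops adele_padic_carrier
          comm_monoid.axioms(1)[OF cring.axioms(2)[OF Qp_cring], THEN monoid.l_one])
  show "(x + y) * z = x * z + y * z"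
  proof (rule adele_eqI)
    fix p :: nat assume p: "prime p"
    interpret Q: cring "Qp p" by (rule Qp_cring[OF p])
    show "adele_padic ((x + y) * z) p = adele_padic (x * z + y * z) p"
      using adele_padic_carrier[OF p] by (simp add: adele_padic_ops[OF p] Q.l_distr)
  qed (simp add: adele_real_ops algebra_simps)
  have "adele_real 0 \<noteq> adele_real 1" by (simp add: adele_real_ops)
  then show "(0 :: adele) \<noteq> 1" by metis
qed

end

lemma adele_real_diff: "adele_real (x - y) = adele_real x - adele_real y"
  by (simp only: minus_adele_def adele_real_ops diff_conv_add_uminus)

lemma adele_padic_diff:
  "prime p \<Longrightarrow> adele_padic (x - y) p = adele_padic x p \<ominus>\<^bsub>Qp p\<^esub> adele_padic y p"
  by (simp only: minus_adele_def adele_padic_ops a_minus_def)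

lemma adele_real_of_rat [simp]: "adele_real (adele_of_rat q) = of_rat q"
  by (simp add: adele_real.rep_eq adele_of_rat.rep_eq)

lemma adele_padic_of_rat [simp]: "prime p \<Longrightarrow> adele_padic (adele_of_rat q) p = Qp_of_rat p q"
  by (simp add: adele_padic.rep_eq adele_of_rat.rep_eq)

lemma adele_of_rat_0 [simp]: "adele_of_rat 0 = 0"
  by (rule adele_eqI) (simp_all add: adele_real_ops adele_padic_ops Qp_of_rat_0)

lemma adele_of_rat_1 [simp]: "adele_of_rat 1 = 1"
  by (rule adele_eqI) (simp_all add: adele_real_ops adele_padic_ops Qp_of_rat_1)

lemma adele_of_rat_add: "adele_of_rat (q + r) = adele_of_rat q + adele_of_rat r"
  by (rule adele_eqI) (simp_all add: adele_real_ops adele_padic_ops Qp_of_rat_add of_rat_add)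

lemma adele_of_rat_mult: "adele_of_rat (q * r) = adele_of_rat q * adele_of_rat r"
  by (rule adele_eqI) (simp_all add: adele_real_ops adele_padic_ops Qp_of_rat_mult of_rat_mult)

lemma adele_of_rat_minus: "adele_of_rat (- q) = - adele_of_rat q"
  by (rule adele_eqI) (simp_all add: adele_real_ops adele_padic_ops Qp_of_rat_uminus of_rat_minus)

lemma adele_of_rat_diff: "adele_of_rat (q - r) = adele_of_rat q - adele_of_rat r"
  using adele_of_rat_add[of q "- r"] by (simp add: adele_of_rat_minus)

definition adele_box :: "real set \<Rightarrow> (nat \<Rightarrow> padic set) \<Rightarrow> adele set" where
  "adele_box U V = {x. adele_real x \<in> U \<and> (\<forall>p. prime p \<longrightarrow> adele_padic x p \<in> V p)}"

text \<open>The restricted product topology: the basic open sets are \<open>U \<times> \<Prod>\<^sub>p V\<^sub>p\<close> with all factors open and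
  \<open>V\<^sub>p = Z\<^sub>p\<close> for all but finitely many \<open>p\<close>.\<close>

instantiation adele :: topological_space
begin

definition open_adele :: "adele set \<Rightarrow> bool" where
  "open_adele = generate_topology
     {adele_box U V | U V. open U \<and> (\<forall>p. prime p \<longrightarrow> openin (Qp_topology p) (V p)) \<and>
                           finite {p. prime p \<and> V p \<noteq> Zp p}}"

instance
proof
  show "open (UNIV :: adele set)"
    unfolding open_adele_def by (rule generate_topology.UNIV)
  show "open (S \<inter> T)" if "open S" "open T" for S T :: "adele set"
    using that unfolding open_adele_def by (rule generate_topology.Int)
  show "open (\<Union>K)" if "\<forall>S\<in>K. open S" for K :: "adele set set"
    using that unfolding open_adele_def by (intro generate_topology.UN) auto
qed

end

definition adele_rat_cong :: "adele \<Rightarrow> adele \<Rightarrow> bool" where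
  "adele_rat_cong x y \<longleftrightarrow> x - y \<in> range adele_of_rat"

lemma equivp_adele_rat_cong: "equivp adele_rat_cong"
proof (rule equivpI)
  have "adele_rat_cong x x" for x
    unfolding adele_rat_cong_def by (rule image_eqI[of _ _ 0]) simp_all
  then show "reflp adele_rat_cong" by (rule reflpI)
  show "symp adele_rat_cong"
  proof (rule sympI)
    fix x y assume "adele_rat_cong x y"
    then obtain q where "x - y = adele_of_rat q" by (auto simp: adele_rat_cong_def)
    then have "y - x = adele_of_rat (- q)" by (simp add: adele_of_rat_minus flip: minus_diff_eq[of x y])
    then show "adele_rat_cong y x" by (simp add: adele_rat_cong_def)
  qed
  show "transp adele_rat_cong"
  proof (rule transpI)
    fix x y z assume "adele_rat_cong x y" "adele_rat_cong y z"
    then obtain q r where "x - y = adele_of_rat q" "y - z = adele_of_rat r"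
      by (auto simp: adele_rat_cong_def)
    then have "x - z = adele_of_rat (q + r)" by (simp add: adele_of_rat_add algebra_simps)
    then show "adele_rat_cong x z" by (auto simp: adele_rat_cong_def)
  qed
qed

quotient_type adele_mod_Q = adele / adele_rat_cong
  morphisms rep_mod_Q mod_Q
  by (rule equivp_adele_rat_cong)

instantiation adele_mod_Q :: ab_group_add
begin

lift_definition zero_adele_mod_Q :: adele_mod_Q is 0 .

lift_definition plus_adele_mod_Q :: "adele_mod_Q \<Rightarrow> adele_mod_Q \<Rightarrow> adele_mod_Q" is "(+)"
proof -
  fix x x' y y' assume "adele_rat_cong x x'" "adele_rat_cong y y'"
  then obtain q r where "x - x' = adele_of_rat q" "y - y' = adele_of_rat r"
    by (auto simp: adele_rat_cong_def)
  then have "(x + y) - (x' + y') = adele_of_rat (q + r)"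
    by (simp add: adele_of_rat_add algebra_simps)
  then show "adele_rat_cong (x + y) (x' + y')" by (auto simp: adele_rat_cong_def)
qed

lift_definition uminus_adele_mod_Q :: "adele_mod_Q \<Rightarrow> adele_mod_Q" is uminus
proof -
  fix x y assume "adele_rat_cong x y"
  then obtain q where "x - y = adele_of_rat q" by (auto simp: adele_rat_cong_def)
  then have "- x - - y = adele_of_rat (- q)" by (simp add: adele_of_rat_minus algebra_simps)
  then show "adele_rat_cong (- x) (- y)" unfolding adele_rat_cong_def by blast
qed

definition minus_adele_mod_Q :: "adele_mod_Q \<Rightarrow> adele_mod_Q \<Rightarrow> adele_mod_Q" where
  "minus_adele_mod_Q \<alpha> \<beta> = \<alpha> + (- \<beta>)"

instance
proof
  fix \<alpha> \<beta> \<gamma> :: adele_mod_Q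
  note refl = equivp_reflp[OF equivp_adele_rat_cong]
  show "\<alpha> + \<beta> + \<gamma> = \<alpha> + (\<beta> + \<gamma>)" by transfer (simp add: add.assoc refl)
  show "\<alpha> + \<beta> = \<beta> + \<alpha>" by transfer (simp add: add.commute refl)
  show "0 + \<alpha> = \<alpha>" by transfer (simp add: refl)
  show "- \<alpha> + \<alpha> = 0" by transfer (simp add: refl)
  show "\<alpha> - \<beta> = \<alpha> + - \<beta>" by (rule minus_adele_mod_Q_def)
qed

end

text \<open>The quotient topology along the projection \<^term>\<open>mod_Q\<close>.\<close>

instantiation adele_mod_Q :: topological_space
begin

definition open_adele_mod_Q :: "adele_mod_Q set \<Rightarrow> bool" where
  "open_adele_mod_Q U \<longleftrightarrow> open (mod_Q -` U)"

instance
proof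
  show "open (UNIV :: adele_mod_Q set)"
    by (simp add: open_adele_mod_Q_def)
  show "open (S \<inter> T)" if "open S" "open T" for S T :: "adele_mod_Q set"
    using that by (simp add: open_adele_mod_Q_def vimage_Int open_Int)
  show "open (\<Union>K)" if "\<forall>S\<in>K. open S" for K :: "adele_mod_Q set set"
    using that by (simp add: open_adele_mod_Q_def vimage_Union open_UN)
qed

end

lift_definition rat_act :: "rat \<Rightarrow> adele_mod_Q \<Rightarrow> adele_mod_Q" is "\<lambda>\<sigma> x. adele_of_rat \<sigma> * x"
proof -
  fix \<sigma> x y assume "adele_rat_cong x y"
  then obtain q where "x - y = adele_of_rat q" by (auto simp: adele_rat_cong_def)
  then have "adele_of_rat \<sigma> * x - adele_of_rat \<sigma> * y = adele_of_rat (\<sigma> * q)"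
    by (simp add: adele_of_rat_mult flip: right_diff_distrib)
  then show "adele_rat_cong (adele_of_rat \<sigma> * x) (adele_of_rat \<sigma> * y)"
    by (auto simp: adele_rat_cong_def)
qed

definition fundamental_domain :: "adele set" where
  "fundamental_domain = adele_box {0..<1} Zp"

text \<open>The representative is unique, see \<open>fundamental_domain_ex1\<close>.\<close>

definition real_coord :: "adele_mod_Q \<Rightarrow> real" where
  "real_coord \<alpha> = adele_real (THE x. x \<in> fundamental_domain \<and> mod_Q x = \<alpha>)"

definition mult_independent :: "rat \<Rightarrow> rat \<Rightarrow> bool" where
  "mult_independent x y \<longleftrightarrow> x \<noteq> 0 \<and> y \<noteq> 0 \<and>
     (\<forall>m n :: int. x powi m * y powi n = 1 \<longrightarrow> m = 0 \<and> n = 0)"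

lemma mod_Q_eq_iff: "mod_Q x = mod_Q y \<longleftrightarrow> (\<exists>q. x = y + adele_of_rat q)"
  unfolding adele_mod_Q.abs_eq_iff adele_rat_cong_def by (auto simp: algebra_simps)

lemma fundamental_domain_ex1: "\<exists>!x. x \<in> fundamental_domain \<and> mod_Q x = \<alpha>"
proof (rule ex_ex1I)
  obtain x where x: "\<alpha> = mod_Q x" by (metis Quotient_adele_mod_Q Quotient_abs_rep)
  define F where "F = {p. prime p \<and> adele_padic x p \<notin> Zp p}"
  have F: "finite F" unfolding F_def by (rule finite_adele_nonintegral)
  have "\<exists>s. Qp_norm p (adele_padic x p \<ominus>\<^bsub>Qp p\<^esub> Qp_of_rat p s) \<le> 1 \<and>
            (\<forall>q. prime q \<longrightarrow> q \<noteq> p \<longrightarrow> padic_abs q s \<le> 1)" if p: "prime p" for p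
  proof -
    interpret Q: cring "Qp p" by (rule Qp_cring[OF p])
    have xc: "adele_padic x p \<in> carrier (Qp p)" using adele_padic_carrier[OF p] .
    obtain r where r: "Qp_norm p (adele_padic x p \<ominus>\<^bsub>Qp p\<^esub> Qp_of_rat p r) \<le> 1"
      using Qp_dense_rat[OF p xc, of 1] by auto
    obtain s where s: "padic_abs p (r - s) \<le> 1" "\<And>q. prime q \<Longrightarrow> q \<noteq> p \<Longrightarrow> padic_abs q s \<le> 1"
      using padic_principal_part[OF p, of r] by metis
    have "adele_padic x p \<ominus>\<^bsub>Qp p\<^esub> Qp_of_rat p s
            = (adele_padic x p \<ominus>\<^bsub>Qp p\<^esub> Qp_of_rat p r) \<oplus>\<^bsub>Qp p\<^esub> Qp_of_rat p (r - s)"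
      using xc Qp_of_rat_carrier[OF p]
      by (simp add: Qp_of_rat_diff[OF p] a_minus_def Q.a_assoc Q.r_neg2 Q.r_neg1)
    then have "Qp_norm p (adele_padic x p \<ominus>\<^bsub>Qp p\<^esub> Qp_of_rat p s) \<le> 1"
      using Qp_norm_add[OF p, of "adele_padic x p \<ominus>\<^bsub>Qp p\<^esub> Qp_of_rat p r" "Qp_of_rat p (r - s)"]
        r s(1) xc Qp_of_rat_carrier[OF p] Qp_norm_of_rat[OF p] by simp
    then show ?thesis using s(2) by blast
  qed
  then obtain s where s1: "\<And>p. prime p \<Longrightarrow> Qp_norm p (adele_padic x p \<ominus>\<^bsub>Qp p\<^esub> Qp_of_rat p (s p)) \<le> 1"
    and s2: "\<And>p q. prime p \<Longrightarrow> prime q \<Longrightarrow> q \<noteq> p \<Longrightarrow> padic_abs q (s p) \<le> 1"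
    by metis
  have int_sum: "padic_abs q (\<Sum>p\<in>G. s p) \<le> 1"
    if "finite G" "G \<subseteq> F" "q \<notin> G" "prime q" for q G
    using that
  proof (induction G rule: finite_induct)
    case (insert p G)
    then have "padic_abs q (s p) \<le> 1" using s2 by (auto simp: F_def)
    then show ?case using insert padic_abs_add[of q "s p" "\<Sum>p\<in>G. s p"] by simp
  qed auto
  define t where "t = (\<Sum>p\<in>F. s p)"
  have integral: "adele_padic x q \<ominus>\<^bsub>Qp q\<^esub> Qp_of_rat q t \<in> Zp q" if q: "prime q" for q
  proof (cases "q \<in> F")
    case False
    then have "adele_padic x q \<in> Zp q" using q by (simp add: F_def)
    moreover have "Qp_of_rat q t \<in> Zp q"
      using int_sum[of F q] False q F by (simp add: Qp_of_rat_in_Zp_iff t_def)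
    ultimately show ?thesis using Zp_minus[OF q] by blast
  next
    case True
    interpret Q: cring "Qp q" by (rule Qp_cring[OF q])
    have xc: "adele_padic x q \<in> carrier (Qp q)" using adele_padic_carrier[OF q] .
    have t: "t = s q + (\<Sum>p\<in>F - {q}. s p)" unfolding t_def using F True by (simp add: sum.remove)
    have "adele_padic x q \<ominus>\<^bsub>Qp q\<^esub> Qp_of_rat q t
       = (adele_padic x q \<ominus>\<^bsub>Qp q\<^esub> Qp_of_rat q (s q)) \<ominus>\<^bsub>Qp q\<^esub> Qp_of_rat q (\<Sum>p\<in>F - {q}. s p)"
      unfolding t Qp_of_rat_add[OF q] using xc Qp_of_rat_carrier[OF q]
      by (simp add: a_minus_def Q.minus_add Q.a_assoc)
    moreover have "adele_padic x q \<ominus>\<^bsub>Qp q\<^esub> Qp_of_rat q (s q) \<in> Zp q"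
      using s1[OF q] xc Qp_of_rat_carrier[OF q] by (simp add: Zp_def)
    moreover have "Qp_of_rat q (\<Sum>p\<in>F - {q}. s p) \<in> Zp q"
      using int_sum[of "F - {q}" q] q F by (auto simp: Qp_of_rat_in_Zp_iff)
    ultimately show ?thesis using Zp_minus[OF q] by simp
  qed
  define n where "n = \<lfloor>adele_real x - of_rat t\<rfloor>"
  define y where "y = x - adele_of_rat t - adele_of_rat (of_int n)"
  have "adele_real y = frac (adele_real x - of_rat t)"
    by (simp add: y_def adele_real_diff n_def frac_def)
  then have "adele_real y \<in> {0..<1}" by (simp add: frac_lt_1)
  moreover have "adele_padic y q \<in> Zp q" if q: "prime q" for q
    using Zp_minus[OF q integral[OF q], of "Qp_of_rat q (of_int n)"]
    by (simp add: y_def adele_padic_diff[OF q] q Qp_of_rat_in_Zp_iff[OF q] padic_abs_of_int_le_1)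
  moreover have "mod_Q y = \<alpha>"
  proof -
    have "x = y + adele_of_rat (t + of_int n)"
      by (simp add: y_def adele_of_rat_add)
    then have "mod_Q x = mod_Q y" unfolding mod_Q_eq_iff by blast
    then show ?thesis by (simp add: x)
  qed
  ultimately show "\<exists>x. x \<in> fundamental_domain \<and> mod_Q x = \<alpha>"
    unfolding fundamental_domain_def adele_box_def by blast
next
  fix x y
  assume x: "x \<in> fundamental_domain \<and> mod_Q x = \<alpha>" and y: "y \<in> fundamental_domain \<and> mod_Q y = \<alpha>"
  then have "mod_Q x = mod_Q y" by simp
  then obtain q where q: "x = y + adele_of_rat q" unfolding mod_Q_eq_iff by blast
  have qd: "adele_of_rat q = x - y" by (simp add: q)
  have "padic_abs p q \<le> 1" if p: "prime p" for p
  proof -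
    have "Qp_of_rat p q = adele_padic x p \<ominus>\<^bsub>Qp p\<^esub> adele_padic y p"
      using adele_padic_of_rat[OF p, of q] by (simp add: qd adele_padic_diff[OF p])
    also have "\<dots> \<in> Zp p"
      using x y p by (intro Zp_minus) (auto simp: fundamental_domain_def adele_box_def)
    finally show ?thesis by (simp add: Qp_of_rat_in_Zp_iff[OF p])
  qed
  then have "q \<in> \<int>" by (rule rat_integral_everywhere)
  then obtain k where k: "q = of_int k" by (auto elim: Ints_cases)
  have "(of_rat q :: real) = adele_real (x - y)"
    unfolding qd[symmetric] by simp
  then have "of_int k = adele_real x - adele_real y"
    by (simp add: adele_real_diff k)
  then have "\<bar>of_int k :: real\<bar> < 1" using x y by (auto simp: fundamental_domain_def adele_box_def)
  then have "k = 0" by linarith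
  then show "x = y" by (simp add: q k)
qed

lemma mod_Q_real_coord:
  obtains x where "mod_Q x = \<alpha>" "x \<in> fundamental_domain" "real_coord \<alpha> = adele_real x"
  using theI'[OF fundamental_domain_ex1[of \<alpha>]] that unfolding real_coord_def by blast

lemma real_coord_Rats_iff: "real_coord (mod_Q x) \<in> \<rat> \<longleftrightarrow> adele_real x \<in> \<rat>"
proof -
  obtain y where y: "mod_Q y = mod_Q x" "real_coord (mod_Q x) = adele_real y"
    using mod_Q_real_coord by metis
  obtain q where "y = x + adele_of_rat q" using y(1) unfolding mod_Q_eq_iff by blast
  then have q: "adele_real y = adele_real x + of_rat q" by (simp add: adele_real_ops)
  then have "adele_real x = adele_real y - of_rat q" by simp
  with q show ?thesis unfolding y(2) by (metis Rats_add Rats_diff Rats_of_rat)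
qed

end

theory Submission
  imports Defs "HOL-Number_Theory.Residues"
begin

text \<open>
  An adele class \<open>\<alpha>\<close> is a character \<open>q \<mapsto> \<chi>(q\<alpha>)\<close> of the rationals, and the orbit of \<open>\<alpha>\<close> is dense iff for
  every \<open>M \<ge> 1\<close> the values of the character of \<open>\<alpha>/M\<close> on \<open>\<Sigma>\<close> are dense in the circle. Replacing \<open>\<gamma>\<close> and \<open>\<delta>\<close>
  by \<open>(\<gamma>\<delta>\<^sup>k)\<^sup>2 = r/s\<close> and \<open>\<delta>\<^sup>2 = d\<close>, with \<open>k\<close> so large that \<open>s\<close> is coprime to \<open>d\<close>, only the restriction of
  the character to \<open>\<int>[1/s]\<close> matters, and Furstenberg's argument for \<open>\<times>2, \<times>3\<close> can be run on the dual solenoid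
  of that group.

  If an invariant set of characters contains elements arbitrarily close to \<open>1\<close> whose values at
  the points \<open>1/s\<^sup>K\<close> differ from \<open>1\<close>, then, since the numbers \<open>(r/s)\<^sup>ad\<^sup>b\<close> have
  asymptotically small logarithmic gaps (even with \<open>a\<close> bounded), its values are dense. Applied to the
  quotients of a closed invariant set with infinitely many values at \<open>1\<close>, this shows that these quotients fill
  the solenoid. Hence, unless the orbit closure contains a torsion character, it contains
  progressions \<open>\<theta>, \<theta>u, \<dots>, \<theta>u\<^sup>t\<close> with \<open>u\<close> of order \<open>t\<close>, for arbitrarily large \<open>t\<close>. If it does
  contain a torsion character, then dividing the orbit by it gives elements close to \<open>1\<close>; they
  are not \<open>1\<close> because \<open>\<alpha>\<^sub>\<infinity>\<close> is irrational.
\<close>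

section \<open>Logarithmic gaps between products of two powers\<close>

text \<open>Dividing \<open>n\<close> repeatedly by its gcd with \<open>c\<close> terminates, and
  each divisor split off divides \<open>c\<close>. The lemma isolates the prime-to-\<open>c\<close>
  part of a denominator and of a torsion order.\<close>

lemma nat_split_coprime:
  fixes n c :: nat
  assumes "n > 0"
  obtains a m k where "n = a * m" "a dvd c ^ k" "coprime m c"
proof -
  have "\<exists>a m k. n = a * m \<and> a dvd c ^ k \<and> coprime m c"
    using assms
  proof (induction n rule: less_induct)
    case (less n)
    show ?case
    proof (cases "coprime n c")
      case True
      then show ?thesis by (intro exI[of _ 1] exI[of _ n]) auto
    next
      case False
      define g where "g = gcd n c"
      obtain n' where n': "n = g * n'" unfolding g_def by (meson dvdE gcd_dvd1)
      have "g \<noteq> 1" using False by (auto simp: g_def coprime_iff_gcd_eq_1)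
      with n' less.prems have "n' > 0" "n' < n" by (cases g; auto)+
      then obtain a m k where *: "n' = a * m" "a dvd c ^ k" "coprime m c"
        using less.IH by blast
      moreover have "g * a dvd c ^ Suc k" using *(2) by (simp add: g_def mult_dvd_mono)
      ultimately show ?thesis using n' by (metis mult.assoc)
    qed
  qed
  then show ?thesis using that by blast
qed

text \<open>Approximating a finite grid of the circle takes only finitely many multiples of
  \<omega>, which bounds \<open>a\<close> uniformly in \<open>x\<close>.\<close>

lemma irrational_shifts_dense:
  fixes \<omega> :: real
  assumes "\<omega> \<notin> \<rat>" "e > 0"
  obtains A where "\<And>x. \<exists>a\<le>A. \<exists>m::int. x \<le> real a * \<omega> + of_int m \<and> real a * \<omega> + of_int m \<le> x + e"
proof -
  obtain n :: nat where n: "n > 0" "1 / real n < e / 2"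
    using real_arch_inverse[of "e / 2"] assms(2) by (auto simp: inverse_eq_divide)
  have "\<exists>a m. \<bar>real a * \<omega> + of_int m - real i / real n\<bar> < e / 4" for i
  proof -
    obtain h k where "k > 0" "\<bar>of_int k * \<omega> - of_int h - real i / real n\<bar> < e / 4"
      using sequence_of_fractional_parts_is_dense[OF assms(1), of "e / 4" "real i / real n"] assms(2)
      by (metis divide_pos_pos zero_less_numeral)
    then show ?thesis by (intro exI[of _ "nat k"] exI[of _ "- h"]) simp
  qed
  then obtain a m where am: "\<And>i. \<bar>real (a i) * \<omega> + of_int (m i) - real i / real n\<bar> < e / 4"
    by metis
  show ?thesis
  proof (rule that[of "Max (a ` {..n})"])
    fix x :: real
    \<comment> \<open>The shift by \<open>e / 4\<close> absorbs the approximation error, so that the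
      point found is not below \<open>x\<close>; on the other side,
      \<open>e / 4 + 1 / n + e / 4\<close> stays below \<open>e\<close>.\<close>
    define y where "y = frac (x + e / 4)"
    define i where "i = nat \<lceil>y * n\<rceil>"
    have y: "0 \<le> y" "y < 1" by (simp_all add: y_def frac_lt_1)
    have "y * n \<le> n" using y n(1) by (simp add: mult_le_cancel_right1)
    then have i: "i \<le> n" unfolding i_def by (simp add: nat_le_iff ceiling_le_iff)
    have "0 \<le> y * n" using y(1) by simp
    then have "y * n \<le> i" "i < y * n + 1" unfolding i_def by linarith+
    then have "y \<le> i / n" "i / n < y + 1 / n" using n(1) by (simp_all add: field_simps)
    moreover have "y = x + e / 4 - of_int \<lfloor>x + e / 4\<rfloor>" by (simp add: y_def frac_def)
    ultimately have "x \<le> real (a i) * \<omega> + of_int (m i + \<lfloor>x + e / 4\<rfloor>)"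
      "real (a i) * \<omega> + of_int (m i + \<lfloor>x + e / 4\<rfloor>) \<le> x + e"
      using am[of i] n(2) unfolding of_int_add by linarith+
    moreover have "a i \<le> Max (a ` {..n})" using i by simp
    ultimately show "\<exists>j\<le>Max (a ` {..n}). \<exists>m::int. x \<le> real j * \<omega> + of_int m \<and> real j * \<omega> + of_int m \<le> x + e"
      by blast
  qed
qed

text \<open>To base \<open>D\<close>, the logarithm of \<open>g ^ a * D ^ b\<close> is
  \<open>a * \<omega> + b\<close>, so multiplicative gaps become the additive gaps of integer shifts
  of multiples of \<omega>.\<close>

lemma power_products_gap:
  fixes g D \<eta> :: real
  assumes "g > 0" "D > 1" "ln g / ln D \<notin> \<rat>" "\<eta> > 0"
  obtains A :: nat and T :: real where "T > 0"
    "\<And>y. y \<ge> T \<Longrightarrow> \<exists>a\<le>A. \<exists>b. y \<le> g ^ a * D ^ b \<and> g ^ a * D ^ b \<le> (1 + \<eta>) * y"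
proof -
  define \<omega> where "\<omega> = ln g / ln D"
  have lD: "ln D > 0" using assms by simp
  have e: "ln (1 + \<eta>) / ln D > 0" using assms by simp
  obtain A where A: "\<And>x. \<exists>a\<le>A. \<exists>m::int. x \<le> real a * \<omega> + of_int m \<and> real a * \<omega> + of_int m \<le> x + ln (1 + \<eta>) / ln D"
    using irrational_shifts_dense[OF assms(3) e] unfolding \<omega>_def by metis
  show ?thesis
  \<comment> \<open>Above this threshold the logarithm of \<open>y\<close> exceeds every
    \<open>a * \<omega>\<close> with \<open>a \<le> A\<close>; hence the integer \<open>m\<close> is
    nonnegative and is a legitimate exponent of \<open>D\<close>.\<close>
  proof (rule that[of "D powr (real A * \<bar>\<omega>\<bar>)" A])
    show "0 < D powr (real A * \<bar>\<omega>\<bar>)" using assms by simp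
    fix y assume y: "D powr (real A * \<bar>\<omega>\<bar>) \<le> y"
    then have y0: "y > 0" using assms(2) by (smt (verit) powr_gt_zero)
    have ly: "ln y / ln D \<ge> real A * \<bar>\<omega>\<bar>"
      using ln_mono[OF y] assms(2) lD y0 by (simp add: ln_powr field_simps)
    obtain a m where am: "a \<le> A" "ln y / ln D \<le> real a * \<omega> + of_int m"
      "real a * \<omega> + of_int m \<le> ln y / ln D + ln (1 + \<eta>) / ln D" using A[of "ln y / ln D"] by auto
    have "real a * \<omega> \<le> real A * \<bar>\<omega>\<bar>"
      using am(1) by (intro order_trans[OF mult_left_mono[OF abs_ge_self] mult_right_mono]) auto
    then have "m \<ge> 0" using am(2) ly by linarith
    then obtain b where b: "m = int b" using nonneg_int_cases by blast
    have l: "ln (g ^ a * D ^ b) = (real a * \<omega> + of_int m) * ln D"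
      using assms(1,2) lD by (simp add: ln_mult ln_realpow \<omega>_def b field_simps)
    have "ln ((1 + \<eta>) * y) = ln (1 + \<eta>) + ln y" using y0 assms(4) by (simp add: ln_mult)
    then have "ln y \<le> ln (g ^ a * D ^ b)" "ln (g ^ a * D ^ b) \<le> ln ((1 + \<eta>) * y)"
      unfolding l using am(2,3) lD by (simp_all add: field_simps)
    then have "y \<le> g ^ a * D ^ b \<and> g ^ a * D ^ b \<le> (1 + \<eta>) * y"
      using y0 assms by (simp add: ln_le_cancel_iff)
    then show "\<exists>a\<le>A. \<exists>b. y \<le> g ^ a * D ^ b \<and> g ^ a * D ^ b \<le> (1 + \<eta>) * y"
      using am(1) by blast
  qed
qed

section \<open>The solenoid, its action, and density from small elements\<close>

lemma norm_cis_diff_le: "norm (cis x - cis y) \<le> \<bar>x - y\<bar>"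
proof -
  have "cis x - cis y = cis y * (cis (x - y) - 1)"
    by (simp add: right_diff_distrib cis_mult)
  then have "norm (cis x - cis y) = norm (cis (x - y) - 1)"
    by (simp add: norm_mult)
  also have "\<dots> = 2 * \<bar>sin ((x - y) / 2)\<bar>"
    using dist_exp_i_1[of "x - y"] by (simp add: cis_conv_exp)
  also have "\<dots> \<le> \<bar>x - y\<bar>" using abs_sin_x_le_abs_x[of "(x - y) / 2"] by simp
  finally show ?thesis .
qed

text \<open>A character of \<open>\<int>[1/s]\<close> is encoded by the sequence of its values at \<open>1/s\<^sup>j\<close>; then \<open>act a b\<close> below is
  the action of \<open>(r/s)\<^sup>ad\<^sup>b\<close>.\<close>

definition solenoid :: "nat \<Rightarrow> (nat \<Rightarrow> complex) set" where
  "solenoid s = {\<theta>. \<forall>j. norm (\<theta> j) = 1 \<and> \<theta> (Suc j) ^ s = \<theta> j}"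

lemma solenoid_norm: "\<theta> \<in> solenoid s \<Longrightarrow> norm (\<theta> j) = 1"
  and solenoid_nonzero: "\<theta> \<in> solenoid s \<Longrightarrow> \<theta> j \<noteq> 0"
  by (auto simp: solenoid_def dest: spec[of _ j])

lemma solenoid_power: "\<theta> \<in> solenoid s \<Longrightarrow> \<theta> (j + i) ^ (s ^ i) = \<theta> j"
proof (induction i)
  case (Suc i)
  have "\<theta> (j + Suc i) ^ s ^ Suc i = (\<theta> (Suc (j + i)) ^ s) ^ (s ^ i)"
    by (simp add: power_mult)
  then show ?case using Suc by (simp add: solenoid_def)
qed simp

lemma solenoid_divide: "\<theta> \<in> solenoid s \<Longrightarrow> \<theta>' \<in> solenoid s \<Longrightarrow> (\<lambda>j. \<theta> j / \<theta>' j) \<in> solenoid s"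
  by (simp add: solenoid_def norm_divide power_divide)

lemma solenoid_pow: "\<theta> \<in> solenoid s \<Longrightarrow> (\<lambda>j. \<theta> j ^ n) \<in> solenoid s"
  by (simp add: solenoid_def norm_power) (metis power_commutes power_mult mult.commute)

locale solenoid_action =
  fixes r s d :: nat
  assumes r_pos: "r > 0" and s_pos: "s > 0" and d_gt_1: "d > 1"
    and coprime_rs: "coprime r s" and coprime_sd: "coprime s d"
    and log_irrational: "ln (real r / real s) / ln (real d) \<notin> \<rat>"
begin

definition act :: "nat \<Rightarrow> nat \<Rightarrow> (nat \<Rightarrow> complex) \<Rightarrow> nat \<Rightarrow> complex" where
  "act a b \<theta> = (\<lambda>j. \<theta> (j + a) ^ (r ^ a * d ^ b))"

lemma act_act: "act a b (act a' b' \<theta>) = act (a + a') (b + b') \<theta>"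
  by (simp add: act_def fun_eq_iff power_add ac_simps flip: power_mult)

lemma act_0_0 [simp]: "act 0 0 \<theta> = \<theta>"
  by (simp add: act_def)

lemma act_solenoid: "\<theta> \<in> solenoid s \<Longrightarrow> act a b \<theta> \<in> solenoid s"
  using solenoid_pow[of "\<lambda>j. \<theta> (j + a)" s] by (simp add: act_def solenoid_def)

lemma act_divide: "act a b (\<lambda>j. \<theta> j / \<theta>' j) = (\<lambda>j. act a b \<theta> j / act a b \<theta>' j)"
  by (simp add: act_def power_divide)

lemma act_mult: "act a b (\<lambda>j. \<theta> j * \<theta>' j) = (\<lambda>j. act a b \<theta> j * act a b \<theta>' j)"
  by (simp add: act_def power_mult_distrib)

text \<open>The parameter \<open>k\<close> is there because a torsion character is in general fixed
  only by suitable powers of the two generators; sets built with its help keep only this weaker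
  invariance.\<close>

definition invariant :: "nat \<Rightarrow> (nat \<Rightarrow> complex) set \<Rightarrow> bool" where
  "invariant k S \<longleftrightarrow> S \<subseteq> solenoid s \<and> (\<forall>\<theta>\<in>S. act k 0 \<theta> \<in> S \<and> act 0 k \<theta> \<in> S)"

lemma invariant_act:
  assumes "invariant k S" "\<theta> \<in> S"
  shows "act (k * a) (k * b) \<theta> \<in> S"
proof -
  have 1: "act 0 (k * b) \<theta> \<in> S" for b
  proof (induction b)
    case (Suc b)
    then have "act 0 k (act 0 (k * b) \<theta>) \<in> S" using assms by (simp add: invariant_def)
    then show ?case by (simp add: act_act)
  qed (simp add: assms)
  show ?thesis
  proof (induction a)
    case (Suc a)
    then have "act k 0 (act (k * a) (k * b) \<theta>) \<in> S" using assms by (simp add: invariant_def)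
    then show ?case by (simp add: act_act)
  qed (simp add: 1)
qed

text \<open>The gap lemma bounds \<open>a\<close> by some \<open>A\<close> in advance, so that the point \<open>1/s\<^sup>K\<close> at which a small
  element is chosen can be taken with \<open>K \<ge> L + ka\<close>.\<close>

lemma dense_of_small_elements:
  assumes k: "k > 0" and inv: "invariant k S"
    and small: "\<And>K \<eta>. \<eta> > 0 \<Longrightarrow> \<exists>\<theta>\<in>S. \<theta> K \<noteq> 1 \<and> norm (\<theta> K - 1) < \<eta>"
    and z: "norm z = 1" and \<epsilon>: "\<epsilon> > 0"
  shows "\<exists>\<theta>\<in>S. norm (\<theta> L - z) < \<epsilon>"
proof -
  define g where "g = (real r / real s) ^ k"
  define D where "D = real d ^ k"
  have g: "g > 0" and D: "D > 1"
    using r_pos s_pos d_gt_1 k by (simp_all add: g_def D_def one_less_power)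
  have "ln g / ln D = ln (real r / real s) / ln (real d)"
    using r_pos s_pos d_gt_1 k by (simp add: g_def D_def ln_realpow)
  then have "ln g / ln D \<notin> \<rat>" using log_irrational by simp
  \<comment> \<open>The target angle will be at most \<open>2 * pi\<close>, so this relative
    precision leaves an absolute error of at most \<open>\<epsilon> / 2\<close>.\<close>
  moreover have "\<epsilon> / (4 * pi) > 0" using \<epsilon> by simp
  ultimately obtain A T where T: "T > 0"
    and gap: "\<And>y. y \<ge> T \<Longrightarrow> \<exists>a\<le>A. \<exists>b. y \<le> g ^ a * D ^ b \<and> g ^ a * D ^ b \<le> (1 + \<epsilon> / (4 * pi)) * y"
    using power_products_gap[OF g D] by metis
  have zc: "z = cis (Arg2pi z)"
    using Arg2pi_eq[of z] z by (simp add: cis_conv_exp)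
  \<comment> \<open>\<open>w c\<close> is the angle in \<open>(0, 2 * pi]\<close> that leads from 1
    to \<open>z\<close> in the direction of the sign \<open>c\<close>. It has to be positive,
    because it is reached by scaling a small nonzero angle; the angle 0 is therefore replaced by a
    full turn.\<close>
  define W where "W = (\<lambda>v. if v > 0 then v else v + 2 * pi)"
  define w where "w = (\<lambda>c :: real. if c = 1 then W (Arg2pi z) else 2 * pi - Arg2pi z)"
  have w: "w c > 0" "w c \<le> 2 * pi" "c \<in> {1, -1} \<Longrightarrow> cis (c * w c) = z" for c
  proof -
    have b: "0 \<le> Arg2pi z" "Arg2pi z < 2 * pi" by (simp_all add: Arg2pi_ge_0 Arg2pi_lt_2pi)
    then show "w c > 0" "w c \<le> 2 * pi" by (auto simp: w_def W_def)
    have "cis (Arg2pi z + 2 * pi) = cis (Arg2pi z)" "cis (Arg2pi z - 2 * pi) = cis (Arg2pi z)"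
      by (simp_all flip: cis_mult cis_divide)
    then show "cis (c * w c) = z" if "c \<in> {1, -1}"
      using that zc by (auto simp: w_def W_def)
  qed
  define w0 where "w0 = min (w 1) (w (- 1))"
  \<comment> \<open>For either sign, an angle below \<open>B\<close> forces the scaling factor
    \<open>y\<close> to be at least \<open>T\<close>, where the gap bound applies.\<close>
  define B where "B = w0 / (T * real s ^ (k * A))"
  have "B > 0" using w T s_pos by (simp add: B_def w0_def)
  moreover have "isCont Arg 1" by (intro continuous_at_Arg) simp
  ultimately obtain \<eta> where \<eta>: "\<eta> > 0" "\<And>x. norm (x - 1) < \<eta> \<Longrightarrow> \<bar>Arg x\<bar> < B"
    unfolding continuous_at_eps_delta dist_norm by (auto simp: Arg_1)
  obtain \<theta> where \<theta>: "\<theta> \<in> S" "\<theta> (L + k * A) \<noteq> 1" "norm (\<theta> (L + k * A) - 1) < \<eta>"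
    using small[OF \<eta>(1)] by blast
  define \<phi> where "\<phi> = Arg (\<theta> (L + k * A))"
  have sol: "\<theta> \<in> solenoid s" using inv \<theta>(1) by (auto simp: invariant_def)
  have c: "\<theta> (L + k * A) = cis \<phi>"
    using cis_Arg[of "\<theta> (L + k * A)"] solenoid_norm[OF sol] solenoid_nonzero[OF sol]
    by (simp add: \<phi>_def sgn_div_norm)
  have \<phi>: "\<bar>\<phi>\<bar> < B" "\<phi> \<noteq> 0" using \<eta>(2)[OF \<theta>(3)] \<theta>(2) by (simp add: \<phi>_def, metis c cis_zero)
  \<comment> \<open>Scaling \<open>\<bar>\<phi>\<bar> * s ^ (k * A)\<close> by exactly
    \<open>y\<close> would hit the target angle; the gap bound supplies an available product just
    above \<open>y\<close>.\<close>
  define y where "y = w (sgn \<phi>) / (\<bar>\<phi>\<bar> * real s ^ (k * A))"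
  have "w0 \<le> w (sgn \<phi>)" using \<phi>(2) by (auto simp: w0_def sgn_real_def)
  then have "\<bar>\<phi>\<bar> * (T * real s ^ (k * A)) \<le> w (sgn \<phi>)"
    using \<phi>(1) T s_pos by (simp add: B_def field_simps)
  then have "y \<ge> T" using \<phi>(2) s_pos by (simp add: y_def field_simps)
  then obtain a b where ab: "a \<le> A" "y \<le> g ^ a * D ^ b" "g ^ a * D ^ b \<le> (1 + \<epsilon> / (4 * pi)) * y"
    using gap by blast
  \<comment> \<open>The action reads \<theta> at index \<open>L + k * a\<close>, whose value is a
    power of the value at \<open>L + k * A\<close>; \<open>n\<close> collects both
    exponents.\<close>
  define n where "n = s ^ (k * A - k * a) * (r ^ (k * a) * d ^ (k * b))"
  have ka: "k * a \<le> k * A" using ab(1) by simp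
  have "\<theta> (L + k * a) = \<theta> (L + k * A) ^ s ^ (k * A - k * a)"
    using solenoid_power[OF sol, of "L + k * a" "k * A - k * a"] ka by simp
  then have "act (k * a) (k * b) \<theta> L = cis \<phi> ^ n"
    by (simp add: act_def c n_def power_mult)
  also have "\<dots> = cis (sgn \<phi> * (real n * \<bar>\<phi>\<bar>))"
    by (simp add: Complex.DeMoivre sgn_mult_abs mult.left_commute[of "sgn \<phi>"])
  finally have v: "act (k * a) (k * b) \<theta> L = cis (sgn \<phi> * (real n * \<bar>\<phi>\<bar>))" .
  have "real s ^ (k * A - k * a) = real s ^ (k * A) / real s ^ (k * a)"
    using s_pos ka by (simp add: power_diff)
  then have "real n = real s ^ (k * A) * (g ^ a * D ^ b)"
    by (simp add: n_def g_def D_def power_divide flip: power_mult)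
  then have n: "real n * \<bar>\<phi>\<bar> = (\<bar>\<phi>\<bar> * real s ^ (k * A)) * (g ^ a * D ^ b)" by simp
  have ys: "(\<bar>\<phi>\<bar> * real s ^ (k * A)) * y = w (sgn \<phi>)"
    using \<phi>(2) s_pos by (simp add: y_def)
  have c0: "0 \<le> \<bar>\<phi>\<bar> * real s ^ (k * A)" by simp
  have 1: "w (sgn \<phi>) \<le> real n * \<bar>\<phi>\<bar>"
    using mult_left_mono[OF ab(2) c0] unfolding n ys .
  have 2: "real n * \<bar>\<phi>\<bar> \<le> (1 + \<epsilon> / (4 * pi)) * w (sgn \<phi>)"
    using mult_left_mono[OF ab(3) c0] unfolding n by (metis ys mult.left_commute)
  have "\<epsilon> / (4 * pi) * w (sgn \<phi>) \<le> \<epsilon> / (4 * pi) * (2 * pi)"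
    using w(2) \<epsilon> by (intro mult_left_mono) auto
  then have 3: "\<bar>real n * \<bar>\<phi>\<bar> - w (sgn \<phi>)\<bar> < \<epsilon>"
    using 1 2 \<epsilon> by (simp add: algebra_simps)
  have s1: "\<bar>sgn \<phi>\<bar> = 1" "sgn \<phi> \<in> {1, -1}" using \<phi>(2) by (auto simp: sgn_real_def)
  have "norm (act (k * a) (k * b) \<theta> L - z) \<le> \<bar>sgn \<phi> * (real n * \<bar>\<phi>\<bar>) - sgn \<phi> * w (sgn \<phi>)\<bar>"
    unfolding v by (subst w(3)[OF s1(2), symmetric]) (rule norm_cis_diff_le)
  also have "\<dots> = \<bar>real n * \<bar>\<phi>\<bar> - w (sgn \<phi>)\<bar>"
    by (simp flip: right_diff_distrib add: abs_mult s1(1) \<phi>(2))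
  finally have "norm (act (k * a) (k * b) \<theta> L - z) < \<epsilon>" using 3 by linarith
  then show ?thesis using invariant_act[OF inv \<theta>(1)] by blast
qed

end

section \<open>Torsion and quotients in invariant sets\<close>

lemma power_eq_1_coprime:
  fixes z :: complex
  assumes "z ^ a = 1" "z ^ b = 1" "coprime a b"
  shows "z = 1"
proof (cases "a = 0")
  case False
  then obtain x y where "a * x = b * y + 1"
    using bezout_nat[of a b] assms(3) by (auto simp: coprime_iff_gcd_eq_1)
  then have "z ^ (a * x) = z ^ (b * y) * z" by simp
  then show ?thesis by (simp add: power_mult assms)
qed (use assms in auto)

text \<open>The defining conditions are closed, and the product of closed unit discs is compact by
  Tychonoff.\<close>

lemma compact_solenoid: "compact (solenoid s)"
proof -
  have "compactin (product_topology (\<lambda>_. euclidean) UNIV) (PiE UNIV (\<lambda>_::nat. cball (0::complex) 1))"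
    by (subst compactin_PiE) auto
  then have c: "compact (PiE UNIV (\<lambda>_::nat. cball (0::complex) 1))"
    by (simp add: euclidean_product_topology)
  have "closed {\<theta>::nat \<Rightarrow> complex. \<forall>j. norm (\<theta> j) = 1 \<and> \<theta> (Suc j) ^ s = \<theta> j}"
    by (intro closed_Collect_all closed_Collect_conj closed_Collect_eq continuous_on_norm
        continuous_on_power continuous_on_product_coordinates continuous_on_const)
  then have "closed (solenoid s)" by (simp add: solenoid_def)
  moreover have "solenoid s \<subseteq> PiE UNIV (\<lambda>_::nat. cball (0::complex) 1)"
    by (auto simp: solenoid_norm)
  ultimately show ?thesis using compact_Int_closed[OF c] by (metis inf.absorb2)
qed

lemma tendsto_coordinate:
  fixes f :: "'a \<Rightarrow> nat \<Rightarrow> complex"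
  assumes "(f \<longlongrightarrow> l) F"
  shows "((\<lambda>n. f n j) \<longlongrightarrow> l j) F"
proof -
  have "isCont (\<lambda>x::nat \<Rightarrow> complex. x j) l"
    using continuous_on_product_coordinates[of j] continuous_on_eq_continuous_at[OF open_UNIV] by blast
  then show ?thesis using assms by (rule isCont_tendsto_compose)
qed

lemma infinite_bounded_close_pair:
  fixes A :: "complex set"
  assumes "infinite A" "bounded A" "e > 0"
  obtains x y where "x \<in> A" "y \<in> A" "x \<noteq> y" "norm (x - y) < e"
proof -
  obtain l where "l islimpt A" using bounded_infinite_imp_islimpt[OF _ assms(2,1)] by blast
  then have "infinite (A \<inter> ball l (e / 2))"
    using assms(3) by (simp add: islimpt_eq_infinite_ball)
  then obtain x y where "x \<in> A \<inter> ball l (e / 2)" "y \<in> A \<inter> ball l (e / 2)" "x \<noteq> y"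
    by (metis finite.simps infinite_imp_nonempty insertI1 is_singletonI' is_singleton_def
        finite.emptyI finite_insert)
  moreover from this have "norm (x - y) < e"
    using dist_triangle_half_r[of l x e y] by (simp add: dist_norm)
  ultimately show ?thesis using that by blast
qed

context solenoid_action
begin

text \<open>The powers \<open>d ^ (k * b)\<close> move a value at index 0 within a finite set, so
  each such value is a root of unity and one exponent \<open>N\<close> serves them all. It serves
  every index of \<theta>: \<open>\<theta> (k * i) ^ N\<close> is annihilated by the coprime
  exponents \<open>r ^ (k * i)\<close> and \<open>s ^ (k * i)\<close>, and \<open>\<theta> j\<close>
  is a power of \<open>\<theta> (k * j)\<close>.\<close>

lemma torsion_of_finite:
  assumes k: "k > 0" and inv: "invariant k S" and ne: "\<theta> \<in> S" and fin: "finite ((\<lambda>\<theta>. \<theta> 0) ` S)"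
  obtains N where "N > 0" "\<And>j. \<theta> j ^ N = 1"
proof -
  have sol: "\<theta> \<in> solenoid s" if "\<theta> \<in> S" for \<theta> using inv that by (auto simp: invariant_def)
  have "\<exists>n>0. \<theta> 0 ^ n = 1" if \<theta>: "\<theta> \<in> S" for \<theta>
  proof -
    have "\<theta> 0 ^ (d ^ (k * b)) \<in> (\<lambda>\<theta>. \<theta> 0) ` S" for b
      using imageI[OF invariant_act[OF inv \<theta>, of 0 b], of "\<lambda>\<theta>. \<theta> 0"] by (simp add: act_def)
    then have "range (\<lambda>b. \<theta> 0 ^ (d ^ (k * b))) \<subseteq> (\<lambda>\<theta>. \<theta> 0) ` S"
      by (rule image_subsetI)
    then have "finite (range (\<lambda>b. \<theta> 0 ^ (d ^ (k * b))))" by (rule finite_subset[OF _ fin])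
    then have "\<not> inj (\<lambda>b. \<theta> 0 ^ (d ^ (k * b)))" using infinite_UNIV_nat by (metis finite_imageD)
    then obtain b c where bc: "b < c" "\<theta> 0 ^ (d ^ (k * b)) = \<theta> 0 ^ (d ^ (k * c))"
      by (meson linorder_injI)
    have lt: "d ^ (k * b) < d ^ (k * c)" using bc(1) k d_gt_1 by (intro power_strict_increasing) auto
    then have "\<theta> 0 ^ (d ^ (k * c)) = \<theta> 0 ^ (d ^ (k * b)) * \<theta> 0 ^ (d ^ (k * c) - d ^ (k * b))"
      by (simp flip: power_add)
    then have "\<theta> 0 ^ (d ^ (k * c) - d ^ (k * b)) = 1"
      using bc(2) solenoid_nonzero[OF sol[OF \<theta>], of 0] by simp
    then show ?thesis using lt by (metis zero_less_diff)
  qed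
  then have "\<forall>x\<in>(\<lambda>\<theta>. \<theta> 0) ` S. \<exists>n>0. x ^ n = 1" by blast
  then obtain n where n: "\<And>x. x \<in> (\<lambda>\<theta>. \<theta> 0) ` S \<Longrightarrow> n x > (0::nat) \<and> x ^ n x = 1"
    by metis
  define N where "N = (\<Prod>x\<in>(\<lambda>\<theta>. \<theta> 0) ` S. n x)"
  have N: "N > 0" unfolding N_def using n by (intro prod_pos) auto
  have pN: "\<theta> 0 ^ N = 1" if "\<theta> \<in> S" for \<theta>
  proof -
    have "n (\<theta> 0) dvd N" unfolding N_def using fin that by (intro dvd_prodI) auto
    then show ?thesis using n[of "\<theta> 0"] that by (auto simp: power_mult elim!: dvdE)
  qed
  have a: "\<theta> (k * i) ^ N = 1" for i
  proof (rule power_eq_1_coprime)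
    have "act (k * i) (k * 0) \<theta> \<in> S" by (rule invariant_act[OF inv ne])
    from pN[OF this] show "(\<theta> (k * i) ^ N) ^ (r ^ (k * i)) = 1"
      by (simp add: act_def mult.commute flip: power_mult)
    have "\<theta> (0 + k * i) ^ (s ^ (k * i)) = \<theta> 0" by (rule solenoid_power[OF sol[OF ne]])
    then show "(\<theta> (k * i) ^ N) ^ (s ^ (k * i)) = 1"
      using pN[OF ne] by (metis add_0 mult.commute power_mult)
    show "coprime (r ^ (k * i)) (s ^ (k * i))" using coprime_rs by simp
  qed
  have "\<theta> j ^ N = 1" for j
  proof -
    have "j \<le> k * j" using k by simp
    then have "\<theta> (k * j) ^ (s ^ (k * j - j)) = \<theta> j"
      using solenoid_power[OF sol[OF ne], of j "k * j - j"] by simp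
    then show ?thesis using a[of j] by (metis mult.commute power_mult power_one)
  qed
  then show ?thesis using that N by blast
qed

text \<open>The quotients form an invariant set with small nontrivial elements, so they come close
  to \<open>u\<close> at any single index. Closeness at index \<open>n\<close> passes down to all
  smaller indices, and compactness turns approximate quotients into an exact one.\<close>

lemma quotients_cover_solenoid:
  assumes k: "k > 0" and inv: "invariant k S" and cl: "closed S"
    and inf: "infinite ((\<lambda>\<theta>. \<theta> 0) ` S)" and u: "u \<in> solenoid s"
  obtains \<theta> where "\<theta> \<in> S" "(\<lambda>j. \<theta> j * u j) \<in> S"
proof -
  have sub: "S \<subseteq> solenoid s" using inv by (simp add: invariant_def)
  define Q where "Q = {\<lambda>j. \<theta> j / \<theta>' j | \<theta> \<theta>'. \<theta> \<in> S \<and> \<theta>' \<in> S}"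
  have invQ: "invariant k Q"
    unfolding invariant_def
  proof (intro conjI ballI)
    show "Q \<subseteq> solenoid s" using sub by (auto simp: Q_def intro!: solenoid_divide)
    fix q assume "q \<in> Q"
    then obtain \<theta> \<theta>' where q: "q = (\<lambda>j. \<theta> j / \<theta>' j)" "\<theta> \<in> S" "\<theta>' \<in> S" by (auto simp: Q_def)
    show "act k 0 q \<in> Q" "act 0 k q \<in> Q"
      using inv q(2,3) unfolding q(1) act_divide Q_def invariant_def by blast+
  qed
  have small: "\<exists>q\<in>Q. q K \<noteq> 1 \<and> norm (q K - 1) < \<eta>" if "\<eta> > 0" for K \<eta>
  proof -
    \<comment> \<open>Since the value at 0 is a power of the value at \<open>K\<close>, there are
      infinitely many values at \<open>K\<close>; two of them are close together, and their quotient
      is the small element.\<close>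
    have "(\<lambda>\<theta>. \<theta> 0) ` S = (\<lambda>x. x ^ (s ^ K)) ` (\<lambda>\<theta>. \<theta> K) ` S"
      unfolding image_image using solenoid_power[of _ s 0 K] sub by (intro image_cong) auto
    then have "infinite ((\<lambda>\<theta>. \<theta> K) ` S)" using inf by (metis finite_imageI)
    moreover have "bounded ((\<lambda>\<theta>. \<theta> K) ` S)"
      using sub solenoid_norm by (intro boundedI[of _ 1]) fastforce
    ultimately obtain x y where xy: "x \<in> (\<lambda>\<theta>. \<theta> K) ` S" "y \<in> (\<lambda>\<theta>. \<theta> K) ` S" "x \<noteq> y" "norm (x - y) < \<eta>"
      using infinite_bounded_close_pair \<open>\<eta> > 0\<close> by metis
    then obtain \<theta> \<theta>' where *: "\<theta> \<in> S" "\<theta>' \<in> S" "\<theta> K \<noteq> \<theta>' K" "norm (\<theta> K - \<theta>' K) < \<eta>"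
      by blast
    have "norm (\<theta>' K) = 1" "\<theta>' K \<noteq> 0"
      using solenoid_norm solenoid_nonzero *(2) sub by blast+
    moreover from this have "\<theta> K / \<theta>' K - 1 = (\<theta> K - \<theta>' K) / \<theta>' K"
      by (simp add: diff_divide_distrib)
    ultimately have "norm (\<theta> K / \<theta>' K - 1) = norm (\<theta> K - \<theta>' K)" "\<theta> K / \<theta>' K \<noteq> 1"
      using *(3) by (auto simp: norm_divide)
    then show ?thesis using * by (intro bexI[of _ "\<lambda>j. \<theta> j / \<theta>' j"]) (auto simp: Q_def)
  qed
  \<comment> \<open>Descending from index \<open>n\<close> to \<open>j\<close> raises to the power
    \<open>s ^ (n - j)\<close>, which multiplies the error by at most \<open>s ^ n\<close>; the
    factor \<open>Suc n\<close> still makes it tend to 0.\<close>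
  define e where "e = (\<lambda>n. 1 / (real s ^ n * real (Suc n)))"
  have e: "e n > 0" for n using s_pos by (simp add: e_def)
  have "\<exists>P\<in>S \<times> S. norm (fst P n / snd P n - u n) < e n" for n
    using dense_of_small_elements[OF k invQ small _ e, of "u n" n n] solenoid_norm[OF u]
    by (auto simp: Q_def)
  then obtain P where P: "\<And>n. P n \<in> S \<times> S" "\<And>n. norm (fst (P n) n / snd (P n) n - u n) < e n"
    by metis
  have "compact S" using compact_Int_closed[OF compact_solenoid cl] sub by (metis inf.absorb2)
  then have "seq_compact (S \<times> S)" by (intro compact_imp_seq_compact compact_Times)
  then obtain l \<phi> where l: "l \<in> S \<times> S" "strict_mono \<phi>" "(P \<circ> \<phi>) \<longlonglongrightarrow> l"
    using P(1) unfolding seq_compact_def by metis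
  have close: "norm (fst (P n) j - snd (P n) j * u j) \<le> 1 / real (Suc n)" if "j \<le> n" for j n
  proof -
    define m where "m = s ^ (n - j)"
    have Ps: "fst (P n) \<in> solenoid s" "snd (P n) \<in> solenoid s" using P(1)[of n] sub by auto
    define q where "q = (\<lambda>j. fst (P n) j / snd (P n) j)"
    have q: "q \<in> solenoid s" unfolding q_def using Ps by (rule solenoid_divide)
    have "norm (q j - u j) = norm (q n ^ m - u n ^ m)"
      using solenoid_power[OF q, of j "n - j"] solenoid_power[OF u, of j "n - j"] that
      by (simp add: m_def)
    also have "\<dots> \<le> m * norm (q n - u n)"
      by (rule norm_power_diff) (simp_all add: solenoid_norm[OF q] solenoid_norm[OF u])
    also have "\<dots> \<le> s ^ n * e n"
      using less_imp_le[OF P(2)[of n]] s_pos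
      by (intro mult_mono) (auto simp: m_def q_def intro: power_increasing)
    also have "\<dots> = 1 / real (Suc n)" using s_pos by (simp add: e_def)
    finally have "norm (q j - u j) \<le> 1 / real (Suc n)" .
    moreover have "fst (P n) j - snd (P n) j * u j = snd (P n) j * (q j - u j)"
      using solenoid_nonzero[OF Ps(2), of j] by (simp add: q_def algebra_simps)
    ultimately show ?thesis by (simp add: norm_mult solenoid_norm[OF Ps(2)])
  qed
  have "fst l j = snd l j * u j" for j
  proof -
    have "(\<lambda>n. fst (P (\<phi> n)) j - snd (P (\<phi> n)) j * u j) \<longlonglongrightarrow> fst l j - snd l j * u j"
      using l(3) by (intro tendsto_intros tendsto_coordinate tendsto_fst tendsto_snd) (simp_all add: o_def)
    moreover have "(\<lambda>n. fst (P (\<phi> n)) j - snd (P (\<phi> n)) j * u j) \<longlonglongrightarrow> 0"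
    proof (rule Lim_null_comparison)
      show "(\<lambda>n. 1 / real (Suc (\<phi> n))) \<longlonglongrightarrow> 0"
        using LIMSEQ_subseq_LIMSEQ[OF LIMSEQ_Suc[OF lim_const_over_n[of 1]] l(2)] by (simp add: o_def)
      have "j \<le> \<phi> n" if "n \<ge> j" for n using seq_suble[OF l(2), of n] that by simp
      then show "\<forall>\<^sub>F n in sequentially. norm (fst (P (\<phi> n)) j - snd (P (\<phi> n)) j * u j) \<le> 1 / real (Suc (\<phi> n))"
        by (intro eventually_sequentiallyI[of j] close)
    qed
    ultimately show ?thesis using LIMSEQ_unique by fastforce
  qed
  then have "fst l = (\<lambda>j. snd l j * u j)" by blast
  then show ?thesis using that[of "snd l"] l(1) by (metis mem_Times_iff)
qed

lemma continuous_on_act: "continuous_on A (act a b)"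
  unfolding act_def
  by (intro continuous_on_coordinatewise_then_product continuous_on_power
      continuous_on_subset[OF continuous_on_product_coordinates]) simp

end

section \<open>Roots of unity in the solenoid\<close>

lemma power_cong_root_of_unity:
  fixes z :: complex
  assumes "z ^ m = 1" "[a = b] (mod m)"
  shows "z ^ a = z ^ b"
proof -
  have "z ^ a = z ^ (a mod m)" for a
  proof -
    have "z ^ a = z ^ (m * (a div m) + a mod m)" by simp
    then show ?thesis by (simp only: power_add power_mult assms power_one mult_1)
  qed
  then show ?thesis using assms(2) by (metis unique_euclidean_semiring_class.cong_def)
qed

text \<open>As \<open>s\<close> is invertible modulo \<open>t\<close>, successive
  \<open>s\<close>-th roots can be taken inside the group of \<open>t\<close>-th roots of unity, by
  raising to the power \<open>s'\<close>.\<close>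

lemma solenoid_root_of_unity:
  assumes t: "t > 0" and co: "coprime s t"
  obtains u where "u \<in> solenoid s" "\<And>j. u j ^ t = 1" "u 0 = cis (2 * pi / t)"
proof -
  obtain s' where s': "[s * s' = 1] (mod t)"
    using cong_solve_coprime_nat[OF co] by auto
  define u where "u = (\<lambda>j. cis (2 * pi / t) ^ (s' ^ j))"
  have z: "cis (2 * pi / t) ^ t = 1"
    using t by (simp add: Complex.DeMoivre)
  have "u (Suc j) ^ s = u j" for j
  proof -
    have "u (Suc j) ^ s = cis (2 * pi / t) ^ (s' ^ j * (s * s'))"
      by (simp add: u_def ac_simps flip: power_mult)
    also have "\<dots> = cis (2 * pi / t) ^ (s' ^ j * 1)"
      by (intro power_cong_root_of_unity[OF z] cong_mult cong_refl s')
    finally show ?thesis by (simp add: u_def)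
  qed
  then have "u \<in> solenoid s" by (simp add: solenoid_def u_def norm_power)
  moreover have "u j ^ t = 1" for j
    by (simp add: u_def mult.commute[of _ t] power_mult z flip: power_mult)
       (simp add: power_mult z)
  ultimately show ?thesis using that by (simp add: u_def)
qed

context solenoid_action
begin

text \<open>On \<open>m\<close>-torsion, exponents matter only modulo \<open>m\<close>, and by
  Euler's theorem the \<open>totient m\<close>-th powers of \<open>r\<close>, \<open>s\<close> and
  \<open>d\<close> are all 1 there.\<close>

lemma act_totient_fixes_torsion:
  assumes "\<phi> \<in> solenoid s" "\<And>j. \<phi> j ^ m = 1" "coprime m (r * s * d)"
  shows "act (totient m) 0 \<phi> = \<phi>" "act 0 (totient m) \<phi> = \<phi>"
proof -
  have "coprime r m" "coprime s m" "coprime d m"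
    using assms(3) by (auto simp: coprime_commute)
  then have c: "[r ^ totient m = 1] (mod m)" "[s ^ totient m = 1] (mod m)" "[d ^ totient m = 1] (mod m)"
    using euler_theorem by blast+
  show "act (totient m) 0 \<phi> = \<phi>"
  proof
    fix j
    have "[r ^ totient m = s ^ totient m] (mod m)" using c(1,2) by (metis cong_sym cong_trans)
    then have "\<phi> (j + totient m) ^ (r ^ totient m) = \<phi> (j + totient m) ^ (s ^ totient m)"
      by (rule power_cong_root_of_unity[OF assms(2)])
    then show "act (totient m) 0 \<phi> j = \<phi> j" by (simp add: act_def solenoid_power[OF assms(1)])
  qed
  show "act 0 (totient m) \<phi> = \<phi>"
    using power_cong_root_of_unity[OF assms(2) c(3)] by (simp add: act_def)
qed

section \<open>The orbit closure of a nontorsion character\<close>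

context
  fixes \<alpha> :: "nat \<Rightarrow> complex"
  assumes \<alpha>: "\<alpha> \<in> solenoid s" and nontorsion: "\<And>j n. n > 0 \<Longrightarrow> \<alpha> j ^ n \<noteq> 1"
begin

definition orbit :: "(nat \<Rightarrow> complex) set" where
  "orbit = {act a b \<alpha> | a b. True}"

lemma act_orbit: "\<theta> \<in> orbit \<Longrightarrow> act a b \<theta> \<in> orbit"
  unfolding orbit_def by (auto simp: act_act) blast

lemma orbit_subset: "orbit \<subseteq> solenoid s"
  by (auto simp: orbit_def intro: act_solenoid \<alpha>)

lemma orbit_nontorsion: "\<theta> \<in> orbit \<Longrightarrow> n > 0 \<Longrightarrow> \<theta> j ^ n \<noteq> 1"
  using nontorsion[of "r ^ a * d ^ b * n" for a b] r_pos d_gt_1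
  by (auto simp: orbit_def act_def simp flip: power_mult)

lemma closure_orbit_subset: "closure orbit \<subseteq> solenoid s"
  by (intro closure_minimal orbit_subset compact_imp_closed compact_solenoid)

lemma act_closure_orbit:
  assumes "\<theta> \<in> closure orbit"
  shows "act a b \<theta> \<in> closure orbit"
proof -
  have "act a b ` closure orbit \<subseteq> closure orbit"
    by (rule image_closure_subset[OF continuous_on_act closed_closure])
       (use act_orbit closure_subset in blast)
  then show ?thesis using assms by blast
qed

lemma orbit_approaches:
  assumes "\<phi> \<in> closure orbit" "\<eta> > 0"
  obtains \<theta> where "\<theta> \<in> orbit" "norm (\<theta> K - \<phi> K) < \<eta>"
proof -
  obtain x where x: "\<And>n. x n \<in> orbit" "x \<longlonglongrightarrow> \<phi>"
    using assms(1) unfolding closure_sequential by blast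
  from tendsto_coordinate[OF x(2), of K] obtain n where "norm (x n K - \<phi> K) < \<eta>"
    using LIMSEQ_D[OF _ assms(2)] by (metis order_refl)
  then show ?thesis using that x(1) by blast
qed

text \<open>After division by a torsion limit point the orbit has values arbitrarily close to 1, but
  never equal to 1, since no value of the orbit is a root of unity.\<close>

lemma dense_if_torsion_in_closure:
  assumes \<theta>: "\<theta> \<in> closure orbit" and N: "N > 0" "\<And>j. \<theta> j ^ N = 1"
    and z: "norm z = 1" and \<epsilon>: "\<epsilon> > 0"
  shows "\<exists>\<theta>\<in>orbit. norm (\<theta> 0 - z) < \<epsilon>"
proof -
  obtain A m c where c: "N = A * m" "A dvd (r * s * d) ^ c" "coprime m (r * s * d)"
    using nat_split_coprime[OF N(1)] by blast
  have m: "m > 0" using N c(1) by simp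
  \<comment> \<open>Acting removes from the order of \<open>\<theta>\<close> the part not coprime to \<open>rsd\<close>.\<close>
  define \<phi> where "\<phi> = act c c \<theta>"
  have \<phi>: "\<phi> \<in> closure orbit" unfolding \<phi>_def by (rule act_closure_orbit[OF \<theta>])
  then have \<phi>s: "\<phi> \<in> solenoid s" using closure_orbit_subset by blast
  have tor: "\<phi> j ^ m = 1" for j
  proof -
    have "\<theta> \<in> solenoid s" using \<theta> closure_orbit_subset by blast
    then have "\<theta> (j + c + c) ^ (s ^ c) = \<theta> (j + c)" by (rule solenoid_power)
    then have "\<phi> j = (\<theta> (j + c + c) ^ (s ^ c)) ^ (r ^ c * d ^ c)"
      by (simp add: \<phi>_def act_def)
    then have "\<phi> j ^ m = \<theta> (j + c + c) ^ ((r * s * d) ^ c * m)"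
      by (simp add: power_mult_distrib ac_simps flip: power_mult)
    moreover have "N dvd (r * s * d) ^ c * m" using c(1,2) by (simp add: mult_dvd_mono)
    ultimately show ?thesis using N(2) by (metis dvdE power_mult power_one)
  qed
  \<comment> \<open>The \<open>k\<close>-th powers of both generators fix \<phi>, so the translated
    orbit \<open>H\<close> stays invariant under them.\<close>
  define k where "k = totient m"
  have k: "k > 0" using m by (simp add: k_def)
  define H where "H = {\<lambda>j. \<theta> j / \<phi> j | \<theta>. \<theta> \<in> orbit}"
  have inv: "invariant k H"
    unfolding invariant_def
  proof (intro conjI ballI)
    show "H \<subseteq> solenoid s"
      using subsetD[OF orbit_subset] \<phi>s by (auto simp: H_def intro!: solenoid_divide)
    fix h assume "h \<in> H"
    then obtain \<theta> where h: "h = (\<lambda>j. \<theta> j / \<phi> j)" "\<theta> \<in> orbit" by (auto simp: H_def)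
    have "act k 0 \<phi> = \<phi>" "act 0 k \<phi> = \<phi>"
      using act_totient_fixes_torsion[OF \<phi>s tor c(3)] by (simp_all add: k_def)
    then show "act k 0 h \<in> H" "act 0 k h \<in> H"
      unfolding h(1) act_divide H_def using act_orbit[OF h(2)] by auto
  qed
  have quot: "norm (x / \<phi> j - y / \<phi> j) = norm (x - y)" for x y j
    by (simp add: norm_divide solenoid_norm[OF \<phi>s] flip: diff_divide_distrib)
  have small: "\<exists>h\<in>H. h K \<noteq> 1 \<and> norm (h K - 1) < \<eta>" if "\<eta> > 0" for K \<eta>
  proof -
    obtain \<theta> where \<theta>: "\<theta> \<in> orbit" "norm (\<theta> K - \<phi> K) < \<eta>"
      using orbit_approaches[OF \<phi> \<open>\<eta> > 0\<close>] by blast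
    have "\<theta> K \<noteq> \<phi> K" using tor[of K] orbit_nontorsion[OF \<theta>(1) m] by metis
    then have "\<theta> K / \<phi> K \<noteq> 1" by auto
    moreover have "norm (\<theta> K / \<phi> K - 1) < \<eta>"
      using quot[of "\<theta> K" K "\<phi> K"] \<theta>(2) solenoid_nonzero[OF \<phi>s] by simp
    ultimately show ?thesis using \<theta>(1) by (intro bexI[of _ "\<lambda>j. \<theta> j / \<phi> j"]) (auto simp: H_def)
  qed
  \<comment> \<open>Division by \<open>\<phi> 0\<close> preserves distances, so approaching
    \<open>z / \<phi> 0\<close> from \<open>H\<close> is the same as approaching \<open>z\<close>
    from the orbit.\<close>
  have "norm (z / \<phi> 0) = 1" using z by (simp add: norm_divide solenoid_norm[OF \<phi>s])
  from dense_of_small_elements[OF k inv small this \<epsilon>, of 0]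
  obtain \<theta> where "\<theta> \<in> orbit" "norm (\<theta> 0 / \<phi> 0 - z / \<phi> 0) < \<epsilon>" by (auto simp: H_def)
  then show ?thesis unfolding quot by blast
qed

text \<open>Furstenberg's induction: the starting points of progressions with \<open>i\<close> steps
  form a closed set \<open>S\<close>, invariant because \<open>u\<close> is fixed. Without torsion
  \<open>S\<close> has infinitely many values at 0, so \<open>u\<close> is a quotient of two
  elements of \<open>S\<close>, and these prolong the progression by one step.\<close>

lemma closure_contains_progression:
  assumes u: "u \<in> solenoid s" "act k 0 u = u" "act 0 k u = u" and k: "k > 0"
    and notor: "\<And>\<theta> N. \<theta> \<in> closure orbit \<Longrightarrow> N > 0 \<Longrightarrow> \<exists>j. \<theta> j ^ N \<noteq> 1"
  shows "\<exists>\<theta>\<in>closure orbit. \<forall>j\<le>i. (\<lambda>n. \<theta> n * u n ^ j) \<in> closure orbit"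
proof (induction i)
  case 0
  have "orbit \<noteq> {}" by (auto simp: orbit_def)
  then show ?case using closure_subset by fastforce
next
  case (Suc i)
  define S where "S = {\<theta>\<in>closure orbit. \<forall>j\<le>i. (\<lambda>n. \<theta> n * u n ^ j) \<in> closure orbit}"
  have inv: "invariant k S"
    unfolding invariant_def
  proof (intro conjI ballI)
    show "S \<subseteq> solenoid s" using closure_orbit_subset by (auto simp: S_def)
    have *: "act a b \<theta> \<in> S" if \<theta>: "\<theta> \<in> S" and fixed: "act a b u = u" for a b \<theta>
    proof -
      have "act a b (\<lambda>n. u n ^ j) = (\<lambda>n. act a b u n ^ j)" for j
        by (simp add: act_def mult.commute flip: power_mult)
      then have "act a b (\<lambda>n. \<theta> n * u n ^ j) = (\<lambda>n. act a b \<theta> n * u n ^ j)" for j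
        by (simp add: act_mult fixed)
      then have "(\<lambda>n. act a b \<theta> n * u n ^ j) \<in> closure orbit" if "j \<le> i" for j
        using act_closure_orbit[of "\<lambda>n. \<theta> n * u n ^ j" a b] \<theta> that by (simp add: S_def)
      then show ?thesis using act_closure_orbit[of \<theta> a b] \<theta> by (simp add: S_def)
    qed
    show "act k 0 \<theta> \<in> S" "act 0 k \<theta> \<in> S" if "\<theta> \<in> S" for \<theta>
      using * that u by blast+
  qed
  have "closed ((\<lambda>\<theta> n. \<theta> n * u n ^ j) -` closure orbit)" for j
    by (intro closed_vimage closed_closure continuous_on_coordinatewise_then_product
        continuous_on_mult continuous_on_const continuous_on_product_coordinates)
  then have "closed (closure orbit \<inter> (\<Inter>j\<in>{..i}. (\<lambda>\<theta> n. \<theta> n * u n ^ j) -` closure orbit))"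
    by (intro closed_Int closed_closure closed_INT) auto
  also have "closure orbit \<inter> (\<Inter>j\<in>{..i}. (\<lambda>\<theta> n. \<theta> n * u n ^ j) -` closure orbit) = S"
    by (auto simp: S_def)
  finally have cl: "closed S" .
  obtain \<theta>0 where \<theta>0: "\<theta>0 \<in> S" using Suc by (auto simp: S_def)
  have "infinite ((\<lambda>\<theta>. \<theta> 0) ` S)"
  proof
    assume "finite ((\<lambda>\<theta>. \<theta> 0) ` S)"
    then obtain N where "N > 0" "\<And>j. \<theta>0 j ^ N = 1"
      using torsion_of_finite[OF k inv \<theta>0] by blast
    then show False using notor[of \<theta>0 N] \<theta>0 by (auto simp: S_def)
  qed
  then obtain \<theta> where \<theta>: "\<theta> \<in> S" "(\<lambda>j. \<theta> j * u j) \<in> S"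
    using quotients_cover_solenoid[OF k inv cl _ u(1)] by blast
  have "(\<lambda>n. \<theta> n * u n ^ j) \<in> closure orbit" if "j \<le> Suc i" for j
  proof (cases j)
    case 0
    then show ?thesis using \<theta>(1) by (simp add: S_def)
  next
    case (Suc j')
    then show ?thesis using \<theta>(2) that by (simp add: S_def mult.assoc)
  qed
  then show ?case using \<theta>(1) by (auto simp: S_def)
qed

text \<open>Without torsion in the closure, a progression along a primitive \<open>t\<close>-th root
  of unity takes values at 0 spaced by \<open>2 * pi / t\<close> around the whole circle, hence near
  every point.\<close>

lemma orbit_dense:
  assumes z: "norm z = 1" and \<epsilon>: "\<epsilon> > 0"
  shows "\<exists>\<theta>\<in>orbit. norm (\<theta> 0 - z) < \<epsilon>"
proof (cases "\<exists>\<theta>\<in>closure orbit. \<exists>N>0. \<forall>j. \<theta> j ^ N = 1")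
  case True
  then show ?thesis using dense_if_torsion_in_closure[OF _ _ _ z \<epsilon>] by blast
next
  case False
  then have notor: "\<exists>j. \<theta> j ^ N \<noteq> 1" if "\<theta> \<in> closure orbit" "N > 0" for \<theta> N
    using that by blast
  obtain q :: nat where q: "4 * pi / \<epsilon> < real q" using reals_Archimedean2 by blast
  \<comment> \<open>Being 1 modulo \<open>r * s * d\<close> makes \<open>t\<close> coprime to it,
    while \<open>q\<close> makes the spacing \<open>2 * pi / t\<close> less than
    \<open>\<epsilon> / 2\<close>.\<close>
  define t where "t = r * s * d * q + 1"
  have "q \<le> t" using r_pos s_pos d_gt_1 by (simp add: t_def le_SucI)
  then have t: "4 * pi / \<epsilon> < real t" using q by linarith
  have t0: "t > 0" by (simp add: t_def)
  have co: "coprime t (r * s * d)" unfolding t_def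
    by (metis coprime_1_left coprime_commute coprime_add_one_right coprime_mult_right_iff mult.commute coprime_mult_left_iff)
  then have "coprime s t" by (simp add: coprime_commute)
  then obtain u where u: "u \<in> solenoid s" "\<And>j. u j ^ t = 1" "u 0 = cis (2 * pi / t)"
    using solenoid_root_of_unity[OF t0] by blast
  have "totient t > 0" using t0 by simp
  then obtain \<theta> where \<theta>: "\<theta> \<in> closure orbit" "\<And>j. j \<le> t \<Longrightarrow> (\<lambda>n. \<theta> n * u n ^ j) \<in> closure orbit"
    using closure_contains_progression[OF u(1) act_totient_fixes_torsion[OF u(1,2) co] _ notor] by blast
  have \<theta>n: "norm (\<theta> 0) = 1" "\<theta> 0 \<noteq> 0"
    using \<theta>(1) closure_orbit_subset solenoid_norm solenoid_nonzero by blast+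
  define v where "v = Arg2pi (z / \<theta> 0)"
  have v: "0 \<le> v" "v < 2 * pi" by (simp_all add: v_def Arg2pi_ge_0 Arg2pi_lt_2pi)
  have "z / \<theta> 0 = cis v"
    using Arg2pi_eq[of "z / \<theta> 0"] z \<theta>n by (simp add: v_def cis_conv_exp norm_divide)
  then have zv: "z = \<theta> 0 * cis v" using \<theta>n by (simp add: field_simps)
  \<comment> \<open>The index of the last point of the progression not beyond the angle
    \<open>v\<close>.\<close>
  define j where "j = nat \<lfloor>v * t / (2 * pi)\<rfloor>"
  have "0 \<le> v * t / (2 * pi)" using v(1) by simp
  then have j: "j \<le> v * t / (2 * pi)" "v * t / (2 * pi) < j + 1" unfolding j_def by linarith+
  have "v * t / (2 * pi) \<le> t" using v t0 by (simp add: field_simps)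
  then have "j \<le> t" using j(1) by linarith
  define y where "y = (\<lambda>n. \<theta> n * u n ^ j)"
  have y: "y \<in> closure orbit" unfolding y_def by (rule \<theta>(2)[OF \<open>j \<le> t\<close>])
  have "norm (y 0 - z) = norm (cis (j * (2 * pi / t)) - cis v)"
    unfolding y_def zv u(3) Complex.DeMoivre right_diff_distrib[symmetric] by (simp add: norm_mult \<theta>n)
  also have "\<dots> \<le> \<bar>j * (2 * pi / t) - v\<bar>" by (rule norm_cis_diff_le)
  also have "\<dots> \<le> 2 * pi / t"
  proof -
    have "j * (2 * pi / t) \<le> v" "v \<le> (j + 1) * (2 * pi / t)"
      using j t0 by (simp_all add: field_simps)
    then show ?thesis by (simp add: add_divide_distrib distrib_right)
  qed
  also have "\<dots> < \<epsilon> / 2" using t t0 \<epsilon> by (simp add: field_simps)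
  finally have 1: "norm (y 0 - z) < \<epsilon> / 2" .
  have "\<epsilon> / 2 > 0" using \<epsilon> by simp
  then obtain g where g: "g \<in> orbit" "norm (g 0 - y 0) < \<epsilon> / 2"
    using orbit_approaches[OF y] by blast
  have "norm (g 0 - z) < \<epsilon>" using norm_triangle_lt[of "g 0 - y 0" "y 0 - z" \<epsilon>] 1 g(2) by simp
  then show ?thesis using g(1) by blast
qed

end

end

lemma (in solenoid_action) values_dense:
  assumes "\<alpha> \<in> solenoid s" "\<And>j n. n > 0 \<Longrightarrow> \<alpha> j ^ n \<noteq> 1" "norm z = 1" "\<epsilon> > 0"
  shows "\<exists>a b. norm (\<alpha> a ^ (r ^ a * d ^ b) - z) < \<epsilon>"
  using orbit_dense[OF assms(1,2) assms(3,4)] by (auto simp: orbit_def[OF assms(1,2)] act_def) blast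

section \<open>From characters of the rationals to the solenoid\<close>

lemma of_rat_power_int: "(of_rat (x powi n) :: 'a :: field_char_0) = of_rat x powi n"
  by (simp add: power_int_def of_rat_power of_rat_inverse)

lemma ln_power_int:
  fixes x :: real
  assumes "x > 0"
  shows "ln (x powi n) = of_int n * ln x"
  using assms powr_real_of_int'[of x n] by (metis less_imp_le ln_powr less_irrefl)

text \<open>If the ratio were \<open>p / q\<close>, then \<open>x powi q = y powi p\<close>, a
  multiplicative relation with nonzero exponent \<open>q\<close>.\<close>

lemma ln_ratio_irrational:
  fixes x y :: rat
  assumes "mult_independent x y" "x > 0" "y > 0"
  shows "ln (of_rat x :: real) / ln (of_rat y) \<notin> \<rat>"
proof
  assume "ln (of_rat x :: real) / ln (of_rat y) \<in> \<rat>"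
  then obtain p q :: int where q: "q > 0" "ln (of_rat x :: real) / ln (of_rat y) = of_int p / of_int q"
    by (metis Rats_cases')
  have ind: "x powi m * y powi n = 1 \<Longrightarrow> m = 0 \<and> n = 0" for m n
    using assms(1) by (simp add: mult_independent_def)
  have "y \<noteq> 1" using ind[of 0 1] by auto
  then have "ln (of_rat y :: real) \<noteq> 0" using assms(3) by simp
  with q have "of_int q * ln (of_rat x :: real) = of_int p * ln (of_rat y)"
    by (simp add: field_simps)
  then have "ln (of_rat (x powi q) :: real) = ln (of_rat (y powi p))"
    using assms(2,3) by (simp add: of_rat_power_int ln_power_int)
  moreover have "0 < x powi q" "0 < y powi p" using assms(2,3) by simp_all
  ultimately have "x powi q = y powi p" by simp
  then have "x powi q * y powi (- p) = 1"
    using assms(3) by (simp add: power_int_minus)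
  then show False using ind q(1) by force
qed

lemma character_of_nat_mult:
  fixes f :: "rat \<Rightarrow> complex"
  assumes add: "\<And>x y. f (x + y) = f x * f y" and nz: "f 0 = 1"
  shows "f (of_nat n * x) = f x ^ n"
  by (induction n) (simp_all add: nz add distrib_right)

text \<open>The denominator of \<gamma> splits into \<open>A\<close>, built from primes of \<delta>,
  and \<open>m\<close>, prime to \<delta>. A power of \<delta> is a multiple of \<open>A\<close>,
  and the cofactor \<open>e\<close> has no common factor with \<open>m\<close>, so the new fraction
  is again reduced.\<close>

lemma reduced_fraction:
  fixes \<gamma> :: rat and \<delta> :: int
  assumes "\<gamma> \<noteq> 0" "\<delta> \<noteq> 0"
  obtains k m :: nat and r :: int where "m > 0" "r \<noteq> 0" "coprime r (int m)" "coprime (int m) \<delta>"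
    "\<gamma> * of_int \<delta> ^ k = of_int r / of_nat m"
proof -
  obtain r0 s0 where rs: "s0 > 0" "\<gamma> = of_int r0 / of_int s0" "coprime r0 s0"
    by (metis rat_cases_int)
  obtain A m k where m: "nat s0 = A * m" "A dvd nat \<bar>\<delta>\<bar> ^ k" "coprime m (nat \<bar>\<delta>\<bar>)"
    using nat_split_coprime[of "nat s0" "nat \<bar>\<delta>\<bar>"] rs(1) by auto
  have s0: "s0 = int A * int m" using m(1) rs(1) by (metis int_nat_eq less_imp_le of_nat_mult)
  have Am: "A > 0" "m > 0" using s0 rs(1) by (auto intro: Nat.gr0I)
  have "int A dvd \<bar>\<delta>\<bar> ^ k"
    using m(2) by (metis abs_ge_zero int_dvd_int_iff int_nat_eq of_nat_power)
  then have "int A dvd \<delta> ^ k" by (simp flip: power_abs)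
  then obtain e where e: "\<delta> ^ k = int A * e" by (elim dvdE)
  have md: "coprime (int m) \<delta>"
    using m(3) by (metis abs_ge_zero coprime_abs_right_iff coprime_int_iff int_nat_eq)
  have "coprime (int m) (\<delta> ^ k)" using md by simp
  then have "coprime (int m) e" by (simp add: e)
  moreover have "coprime (int m) r0" using rs(3) by (simp add: s0 coprime_commute)
  ultimately have "coprime (r0 * e) (int m)" by (simp add: coprime_commute)
  moreover have "r0 * e \<noteq> 0"
    using assms e rs(2) by auto
  moreover have "\<gamma> * of_int \<delta> ^ k = of_int (r0 * e) / of_nat m"
  proof -
    have "of_int \<delta> ^ k = (of_nat A * of_int e :: rat)"
      by (metis e of_int_mult of_int_of_nat_eq of_int_power)
    then show ?thesis using Am by (simp add: rs(2) s0)
  qed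
  ultimately show ?thesis using that Am(2) md by blast
qed

lemma character_values_dense:
  fixes f :: "rat \<Rightarrow> complex" and \<gamma> :: rat and \<delta> :: int
  assumes add: "\<And>x y. f (x + y) = f x * f y" and norm1: "\<And>x. norm (f x) = 1"
    and nontor: "\<And>x n. x \<noteq> 0 \<Longrightarrow> n > 0 \<Longrightarrow> f x ^ n \<noteq> 1"
    and ind: "mult_independent \<gamma> (of_int \<delta>)" and z: "norm z = 1" and \<epsilon>: "\<epsilon> > 0"
  shows "\<exists>a\<ge>1. \<exists>b\<ge>1. norm (f (\<gamma> ^ a * of_int \<delta> ^ b) - z) < \<epsilon>"
proof -
  have nz: "\<gamma> \<noteq> 0" "\<delta> \<noteq> 0" using ind by (auto simp: mult_independent_def)
  have indep: "\<gamma> powi m * of_int \<delta> powi n = 1 \<Longrightarrow> m = 0 \<and> n = 0" for m n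
    using ind by (simp add: mult_independent_def)
  obtain k m r1 where m: "m > 0" "r1 \<noteq> 0" "coprime r1 (int m)" "coprime (int m) \<delta>"
    and \<gamma>k: "\<gamma> * of_int \<delta> ^ k = of_int r1 / of_nat m"
    by (rule reduced_fraction[OF nz])
  define r where "r = (nat \<bar>r1\<bar>)\<^sup>2"
  define s where "s = m\<^sup>2"
  define d where "d = (nat \<bar>\<delta>\<bar>)\<^sup>2"
  \<comment> \<open>Squaring removes the signs, so that logarithms and natural numbers can be used;
    multiplicative independence survives it.\<close>
  define g where "g = (\<gamma> * of_int \<delta> ^ k)\<^sup>2"
  define D :: rat where "D = (of_int \<delta>)\<^sup>2"
  have D: "of_nat d = D"
  proof -
    have "int d = \<delta>\<^sup>2" by (simp add: d_def)
    then show ?thesis unfolding D_def by (metis of_int_of_nat_eq of_int_power)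
  qed
  have rD: "of_nat r = (of_int r1 :: rat)\<^sup>2"
  proof -
    have "int r = r1\<^sup>2" by (simp add: r_def)
    then show ?thesis by (metis of_int_of_nat_eq of_int_power)
  qed
  have g: "of_nat r / of_nat s = g"
    by (simp add: g_def \<gamma>k rD s_def power_divide)
  have pos: "g > 0" "D > 0" using nz by (simp_all add: g_def D_def)
  have "mult_independent g D"
    unfolding mult_independent_def
  proof (intro conjI allI impI)
    fix a b :: int assume "g powi a * D powi b = 1"
    moreover have "g powi a = \<gamma> powi (2 * a) * of_int \<delta> powi (int k * (2 * a))"
      unfolding g_def power_int_power power_int_mult_distrib by simp
    moreover have "D powi b = of_int \<delta> powi (2 * b)"
      unfolding D_def power_int_power by simp
    ultimately have "\<gamma> powi (2 * a) * of_int \<delta> powi (int k * (2 * a) + 2 * b) = 1"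
      using nz(2) by (simp add: power_int_add)
    from indep[OF this] have "2 * a = 0 \<and> int k * (2 * a) + 2 * b = 0" .
    then show "a = 0" "b = 0" by auto
  qed (use pos in auto)
  then have "ln (of_rat g :: real) / ln (of_rat D) \<notin> \<rat>" using ln_ratio_irrational pos by blast
  then have irr: "ln (real r / real s) / ln (real d) \<notin> \<rat>"
    by (simp flip: g D add: of_rat_divide)
  have d1: "\<bar>\<delta>\<bar> \<noteq> 1"
  proof
    assume "\<bar>\<delta>\<bar> = 1"
    then have "(of_int \<delta> :: rat) powi 2 = 1" by (auto simp: abs_if split: if_splits)
    then show False using indep[of 0 2] by simp
  qed
  have "nat \<bar>\<delta>\<bar> > 1" using d1 nz(2) by linarith
  then have d: "d > 1" unfolding d_def by (rule one_less_power) simp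
  interpret solenoid_action r s d
  proof
    show "r > 0" "s > 0" using m by (simp_all add: r_def s_def)
    show "d > 1" by (rule d)
    have "coprime (nat \<bar>r1\<bar>) m"
      using m(3) by (metis abs_ge_zero coprime_abs_left_iff coprime_int_iff int_nat_eq)
    then show "coprime r s" by (simp add: r_def s_def)
    have "coprime m (nat \<bar>\<delta>\<bar>)"
      using m(4) by (metis abs_ge_zero coprime_abs_right_iff coprime_int_iff int_nat_eq)
    then show "coprime s d" by (simp add: d_def s_def)
  qed (rule irr)
  have f0: "f 0 = 1"
    using add[of 0 0] norm1[of 0] by (metis add.left_neutral mult_cancel_left1 norm_zero zero_neq_one)
  note f_mult = character_of_nat_mult[of f, OF add f0]
  \<comment> \<open>Starting at \<open>g * D\<close> instead of 1 makes both final exponents at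
    least 1.\<close>
  define \<alpha> where "\<alpha> = (\<lambda>j. f (g * D / of_nat s ^ j))"
  have "\<alpha> (Suc j) ^ s = \<alpha> j" for j
    using s_pos by (simp add: \<alpha>_def flip: f_mult)
  then have "\<alpha> \<in> solenoid s" by (simp add: solenoid_def \<alpha>_def norm1)
  moreover have "\<alpha> j ^ n \<noteq> 1" if "n > 0" for j n
    unfolding \<alpha>_def using nontor that pos s_pos by simp
  ultimately obtain a b where ab: "norm (\<alpha> a ^ (r ^ a * d ^ b) - z) < \<epsilon>"
    using values_dense[OF _ _ z \<epsilon>] by blast
  have "of_nat (r ^ a * d ^ b) * (g * D / of_nat s ^ a) = g ^ Suc a * D ^ Suc b"
    unfolding g[symmetric] D[symmetric] by (simp add: power_divide)
  also have "\<dots> = \<gamma> ^ (2 * Suc a) * of_int \<delta> ^ (2 * k * Suc a + 2 * Suc b)"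
    unfolding g_def D_def
    by (simp only: power_mult_distrib power_add mult.assoc flip: power_mult)
       (simp only: ac_simps)
  finally have "\<alpha> a ^ (r ^ a * d ^ b) = f (\<gamma> ^ (2 * Suc a) * of_int \<delta> ^ (2 * k * Suc a + 2 * Suc b))"
    unfolding \<alpha>_def f_mult[symmetric] by simp
  then show ?thesis using ab
    by (intro exI[of _ "2 * Suc a"] exI[of _ "2 * k * Suc a + 2 * Suc b"] conjI) auto
qed

section \<open>The standard character of the adele classes\<close>

lemma cis_2pi_of_int: "cis (2 * pi * (x + of_int n)) = cis (2 * pi * x)"
  using cis_multiple_2pi[of "of_int n"] by (simp add: distrib_left cis_mult[symmetric])

lemma cis_2pi_eqE:
  assumes "cis (2 * pi * x) = cis (2 * pi * y)"
  obtains n :: int where "x = y + of_int n"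
proof -
  obtain n :: int where "\<i> * of_real (2 * pi * x) = \<i> * of_real (2 * pi * y) + (of_int (2 * n) * pi) * \<i>"
    using assms unfolding cis_conv_exp exp_eq by blast
  then have "\<i> * of_real (2 * pi * x) = \<i> * of_real (2 * pi * (y + of_int n))"
    by (simp add: algebra_simps)
  then have "2 * pi * x = 2 * pi * (y + of_int n)"
    by (metis complex_i_not_zero mult_cancel_left of_real_eq_iff)
  then have "x = y + of_int n" by simp
  then show ?thesis by (rule that)
qed

text \<open>Leaving the real coordinate free turns the fundamental domain into an additive subgroup,
  which meets the rationals exactly in the integers.\<close>

definition integral_adeles :: "adele set" where
  "integral_adeles = adele_box UNIV Zp"

lemma integral_adeles_padic: "x \<in> integral_adeles \<Longrightarrow> prime p \<Longrightarrow> adele_padic x p \<in> Zp p"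
  by (simp add: integral_adeles_def adele_box_def)

lemma integral_adeles_add: "x \<in> integral_adeles \<Longrightarrow> y \<in> integral_adeles \<Longrightarrow> x + y \<in> integral_adeles"
  by (simp add: integral_adeles_def adele_box_def adele_padic_ops Zp_add)

lemma integral_adeles_diff: "x \<in> integral_adeles \<Longrightarrow> y \<in> integral_adeles \<Longrightarrow> x - y \<in> integral_adeles"
  by (simp add: integral_adeles_def adele_box_def adele_padic_diff Zp_minus)

lemma integral_adeles_of_int: "adele_of_rat (of_int n) \<in> integral_adeles"
  by (simp add: integral_adeles_def adele_box_def Qp_of_rat_in_Zp_iff padic_abs_of_int_le_1)

lemma adele_of_rat_integral_imp_Ints: "adele_of_rat q \<in> integral_adeles \<Longrightarrow> q \<in> \<int>"
  by (rule rat_integral_everywhere)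
     (metis adele_padic_of_rat integral_adeles_padic Qp_of_rat_in_Zp_iff)

lemma mod_Q_rep:
  obtains y where "mod_Q y = \<alpha>" "y \<in> integral_adeles" "adele_real y = real_coord \<alpha>"
proof -
  obtain y where "mod_Q y = \<alpha>" "y \<in> fundamental_domain" "real_coord \<alpha> = adele_real y"
    by (rule mod_Q_real_coord)
  then show ?thesis
    by (intro that[of y]) (auto simp: fundamental_domain_def integral_adeles_def adele_box_def)
qed

lemma real_coord_integral:
  assumes "x \<in> integral_adeles"
  obtains n :: int where "real_coord (mod_Q x) = adele_real x + of_int n"
proof -
  obtain y where y: "mod_Q y = mod_Q x" "y \<in> integral_adeles" "adele_real y = real_coord (mod_Q x)"
    by (rule mod_Q_rep)
  obtain q where q: "y = x + adele_of_rat q" using y(1) unfolding mod_Q_eq_iff by blast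
  have "y - x \<in> integral_adeles" using y(2) assms by (rule integral_adeles_diff)
  then have "q \<in> \<int>" by (intro adele_of_rat_integral_imp_Ints) (simp add: q)
  then obtain n where "q = of_int n" by (auto elim: Ints_cases)
  then have "adele_real y = adele_real x + of_int n" by (simp add: q adele_real_ops)
  then show ?thesis using that y(3) by metis
qed

text \<open>The usual character of the adeles that is trivial on the rationals and on every
  \<open>Z_p\<close>: its \<open>p\<close>-adic factors disappear on an integral representative, and
  only the real one remains.\<close>

definition std_character :: "adele_mod_Q \<Rightarrow> complex" where
  "std_character \<alpha> = cis (2 * pi * real_coord \<alpha>)"

lemma std_character_integral:
  assumes "x \<in> integral_adeles"
  shows "std_character (mod_Q x) = cis (2 * pi * adele_real x)"
  using real_coord_integral[OF assms] by (metis std_character_def cis_2pi_of_int)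

lemma mod_Q_add: "mod_Q (x + y) = mod_Q x + mod_Q y"
  by (rule plus_adele_mod_Q.abs_eq[symmetric])

lemma std_character_add: "std_character (\<alpha> + \<beta>) = std_character \<alpha> * std_character \<beta>"
proof -
  obtain x where x: "mod_Q x = \<alpha>" "x \<in> integral_adeles" "adele_real x = real_coord \<alpha>"
    by (rule mod_Q_rep)
  obtain y where y: "mod_Q y = \<beta>" "y \<in> integral_adeles" "adele_real y = real_coord \<beta>"
    by (rule mod_Q_rep)
  have "std_character (\<alpha> + \<beta>) = cis (2 * pi * adele_real (x + y))"
    unfolding x(1)[symmetric] y(1)[symmetric] mod_Q_add[symmetric]
    by (rule std_character_integral[OF integral_adeles_add[OF x(2) y(2)]])
  then show ?thesis
    by (simp add: adele_real_ops x(3) y(3) distrib_left std_character_def cis_mult)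
qed

lemma rat_act_mod_Q: "rat_act \<sigma> (mod_Q x) = mod_Q (adele_of_rat \<sigma> * x)"
  by (rule rat_act.abs_eq)

lemma rat_act_add: "rat_act (\<sigma> + \<tau>) \<alpha> = rat_act \<sigma> \<alpha> + rat_act \<tau> \<alpha>"
proof -
  obtain x where "mod_Q x = \<alpha>" by (rule mod_Q_rep)
  then show ?thesis
    by (auto simp: rat_act_mod_Q adele_of_rat_add distrib_right mod_Q_add)
qed

lemma rat_act_add_right: "rat_act \<sigma> (\<alpha> + \<beta>) = rat_act \<sigma> \<alpha> + rat_act \<sigma> \<beta>"
proof -
  obtain x y where "mod_Q x = \<alpha>" "mod_Q y = \<beta>" by (metis mod_Q_rep)
  moreover have "rat_act \<sigma> (mod_Q (x + y)) = rat_act \<sigma> (mod_Q x) + rat_act \<sigma> (mod_Q y)"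
    unfolding rat_act_mod_Q distrib_left by (rule mod_Q_add)
  ultimately show ?thesis by (simp add: mod_Q_add)
qed

lemma rat_act_rat_act: "rat_act \<sigma> (rat_act \<tau> \<alpha>) = rat_act (\<sigma> * \<tau>) \<alpha>"
proof -
  obtain x where "mod_Q x = \<alpha>" by (rule mod_Q_rep)
  then show ?thesis by (auto simp: rat_act_mod_Q adele_of_rat_mult mult.assoc)
qed

lemma real_coord_rat_act_irrational:
  assumes "real_coord \<alpha> \<notin> \<rat>" "\<sigma> \<noteq> 0"
  shows "real_coord (rat_act \<sigma> \<alpha>) \<notin> \<rat>"
proof
  obtain x where x: "mod_Q x = \<alpha>" by (rule mod_Q_rep)
  assume "real_coord (rat_act \<sigma> \<alpha>) \<in> \<rat>"
  then have "of_rat \<sigma> * adele_real x \<in> \<rat>"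
    unfolding x[symmetric] rat_act_mod_Q real_coord_Rats_iff by (simp add: adele_real_ops)
  then have "of_rat \<sigma> * adele_real x / of_rat \<sigma> \<in> \<rat>" by (intro Rats_divide) simp_all
  then have "adele_real x \<in> \<rat>" using assms(2) by simp
  then show False using assms(1) x real_coord_Rats_iff by blast
qed

lemma std_character_nontorsion:
  assumes "real_coord \<alpha> \<notin> \<rat>" "n > 0"
  shows "std_character \<alpha> ^ n \<noteq> 1"
proof
  assume "std_character \<alpha> ^ n = 1"
  then have "cis (2 * pi * (real n * real_coord \<alpha>)) = cis (2 * pi * 0)"
    by (simp add: std_character_def Complex.DeMoivre mult.left_commute)
  then obtain k :: int where "real n * real_coord \<alpha> = of_int k"
    by (elim cis_2pi_eqE) simp
  then have "real_coord \<alpha> = of_int k / of_nat n" using assms(2) by (simp add: field_simps)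
  then show False using assms(1) by simp
qed

section \<open>Neighbourhoods of adeles and of adele classes\<close>

lemma padic_abs_of_nat_mult_le: "prime p \<Longrightarrow> padic_abs p (of_nat (m * n)) \<le> padic_abs p (of_nat m)"
  using padic_abs_mult[of p "of_nat m" "of_nat n"] padic_abs_of_int_le_1[of p "int n"]
    mult_left_le[of "padic_abs p (of_nat n)" "padic_abs p (of_nat m)"] by simp

lemma padic_abs_prime: "prime p \<Longrightarrow> padic_abs p (of_nat p) < 1"
proof -
  assume p: "prime p"
  have "padic_val p (of_int (int p) / of_int 1) = 1"
    by (subst padic_val_divide[OF p]) (use p in \<open>auto simp: prime_gt_0_nat\<close>)
  then have "padic_abs p (of_nat p) = inverse (real p)"
    using prime_gt_0_nat[OF p] by (simp add: padic_abs_def power_int_minus)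
  then show ?thesis using padic_prime_gt_1[OF p] by (simp add: inverse_less_1_iff)
qed

lemma padic_abs_power: "prime p \<Longrightarrow> padic_abs p (x ^ n) = padic_abs p x ^ n"
  by (induction n) (simp_all add: padic_abs_mult padic_abs_1)

lemma Qp_topology_ball:
  assumes p: "prime p" and V: "openin (Qp_topology p) V" "x \<in> V"
  obtains e where "e > 0" "\<And>y. y \<in> carrier (Qp p) \<Longrightarrow> Qp_norm p (y \<ominus>\<^bsub>Qp p\<^esub> x) < e \<Longrightarrow> y \<in> V"
proof -
  interpret M: Metric_space "carrier (Qp p)" "Qp_dist p" by (rule Qp_Metric_space[OF p])
  have "V \<subseteq> carrier (Qp p)" and "\<exists>e>0. M.mball x e \<subseteq> V"
    using V unfolding Qp_topology_def M.openin_mtopology by blast+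
  then obtain e where e: "e > 0" "M.mball x e \<subseteq> V" and x: "x \<in> carrier (Qp p)" using V(2) by blast
  show ?thesis
  proof (rule that[OF e(1)])
    fix y assume y: "y \<in> carrier (Qp p)" "Qp_norm p (y \<ominus>\<^bsub>Qp p\<^esub> x) < e"
    then have "Qp_dist p x y < e" using x M.commute[of x y] by (simp add: Qp_dist_def)
    then show "y \<in> V" using e(2) x y(1) M.in_mball by blast
  qed
qed

text \<open>One modulus \<open>M\<close> encodes the conditions at all primes at once: the
  \<open>p\<close>-adic coordinates of \<open>w\<close> lie in \<open>M\<close> times
  \<open>Z_p\<close>. Intersections are handled by multiplying the moduli.\<close>

lemma open_adele_nbhd:
  assumes "open U" "x \<in> U"
  obtains M :: nat and \<eta> :: real where "M > 0" "\<eta> > 0"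
    "\<And>w. \<bar>adele_real w\<bar> < \<eta> \<Longrightarrow> (\<And>p. prime p \<Longrightarrow> Qp_norm p (adele_padic w p) \<le> padic_abs p (of_nat M))
      \<Longrightarrow> x + w \<in> U"
proof -
  define near where "near = (\<lambda>M \<eta> w. \<bar>adele_real w\<bar> < \<eta> \<and>
    (\<forall>p. prime p \<longrightarrow> Qp_norm p (adele_padic w p) \<le> padic_abs p (of_nat M)))"
  have "generate_topology
     {adele_box U V | U V. open U \<and> (\<forall>p. prime p \<longrightarrow> openin (Qp_topology p) (V p)) \<and>
                           finite {p. prime p \<and> V p \<noteq> Zp p}} U"
    using assms(1) unfolding open_adele_def .
  then have "\<exists>M>0. \<exists>\<eta>>0. \<forall>w. near M \<eta> w \<longrightarrow> x + w \<in> U"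
    using assms(2)
  proof (induction U rule: generate_topology.induct)
    case UNIV
    then show ?case by (intro exI[of _ 1] conjI) auto
  next
    case (Int A B)
    then obtain M N \<eta> \<epsilon> where M: "M > 0" "\<eta> > 0" "\<And>w. near M \<eta> w \<Longrightarrow> x + w \<in> A"
      and N: "N > 0" "\<epsilon> > 0" "\<And>w. near N \<epsilon> w \<Longrightarrow> x + w \<in> B" by auto
    have "near M \<eta> w \<and> near N \<epsilon> w" if "near (M * N) (min \<eta> \<epsilon>) w" for w
      using that padic_abs_of_nat_mult_le[of _ M N] padic_abs_of_nat_mult_le[of _ N M]
      unfolding near_def by (metis (no_types, lifting) min_less_iff_conj mult.commute order_trans)
    then show ?case using M N
      by (intro exI[of _ "M * N"] conjI exI[of _ "min \<eta> \<epsilon>"]) auto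
  next
    case (UN K)
    then show ?case by (metis Union_iff)
  next
    case (Basis B)
    then obtain I V where B: "B = adele_box I V" "open I"
      "\<And>p. prime p \<Longrightarrow> openin (Qp_topology p) (V p)" "finite {p. prime p \<and> V p \<noteq> Zp p}" by auto
    define F where "F = {p. prime p \<and> V p \<noteq> Zp p}"
    have xI: "adele_real x \<in> I" and xV: "\<And>p. prime p \<Longrightarrow> adele_padic x p \<in> V p"
      using Basis.prems by (simp_all add: B(1) adele_box_def)
    obtain \<eta> where \<eta>: "\<eta> > 0" "\<And>t. \<bar>t - adele_real x\<bar> < \<eta> \<Longrightarrow> t \<in> I"
      using B(2) xI unfolding open_dist dist_real_def by blast
    have "\<exists>k. \<forall>y\<in>carrier (Qp p). Qp_norm p (y \<ominus>\<^bsub>Qp p\<^esub> adele_padic x p) \<le> padic_abs p (of_nat (p ^ k)) \<longrightarrow> y \<in> V p"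
      if p: "prime p" for p
    proof -
      obtain e where e: "e > 0" "\<And>y. y \<in> carrier (Qp p) \<Longrightarrow> Qp_norm p (y \<ominus>\<^bsub>Qp p\<^esub> adele_padic x p) < e \<Longrightarrow> y \<in> V p"
        using Qp_topology_ball[OF p B(3)[OF p] xV[OF p]] by metis
      obtain k where "padic_abs p (of_nat p) ^ k < e"
        using real_arch_pow_inv[OF e(1) padic_abs_prime[OF p]] by blast
      then have "padic_abs p (of_nat (p ^ k)) < e" by (simp add: padic_abs_power[OF p])
      then show ?thesis using e(2) by (meson le_less_trans)
    qed
    then obtain k where k: "\<And>p y. prime p \<Longrightarrow> y \<in> carrier (Qp p) \<Longrightarrow>
      Qp_norm p (y \<ominus>\<^bsub>Qp p\<^esub> adele_padic x p) \<le> padic_abs p (of_nat (p ^ k p)) \<Longrightarrow> y \<in> V p"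
      by metis
    \<comment> \<open>Only the finitely many primes with \<open>V p \<noteq> Zp p\<close> need a
      power in \<open>M\<close>; at the others integrality of \<open>w\<close> suffices, because
      \<open>Zp p\<close> is closed under addition.\<close>
    define M where "M = (\<Prod>p\<in>F. p ^ k p)"
    have M: "M > 0" unfolding M_def by (intro prod_pos) (auto simp: F_def prime_gt_0_nat)
    have "x + w \<in> B" if w: "near M \<eta> w" for w
    proof -
      have "adele_real (x + w) \<in> I" using w \<eta>(2) by (simp add: near_def adele_real_ops)
      moreover have "adele_padic (x + w) p \<in> V p" if p: "prime p" for p
      proof -
        have c: "adele_padic x p \<in> carrier (Qp p)" "adele_padic w p \<in> carrier (Qp p)"
          by (simp_all add: adele_padic_carrier[OF p])
        have wn: "Qp_norm p (adele_padic w p) \<le> padic_abs p (of_nat M)"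
          using w p by (simp add: near_def)
        show ?thesis
        proof (cases "p \<in> F")
          case True
          have "M = p ^ k p * (\<Prod>q\<in>F - {p}. q ^ k q)"
            unfolding M_def using True B(4) by (intro prod.remove) (auto simp: F_def)
          then have "padic_abs p (of_nat M) \<le> padic_abs p (of_nat (p ^ k p))"
            using padic_abs_of_nat_mult_le[OF p] by metis
          moreover have "adele_padic (x + w) p \<ominus>\<^bsub>Qp p\<^esub> adele_padic x p = adele_padic w p"
            by (simp flip: adele_padic_diff[OF p])
          ultimately show ?thesis using wn by (intro k p adele_padic_carrier) simp
        next
          case False
          then have V: "V p = Zp p" using p by (simp add: F_def)
          have "padic_abs p (of_nat M) \<le> 1" using padic_abs_of_int_le_1[OF p, of "int M"] by simp
          then have "adele_padic w p \<in> Zp p" using wn c by (simp add: Zp_def)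
          then show ?thesis using xV[OF p] by (simp add: V adele_padic_ops[OF p] Zp_add[OF p])
        qed
      qed
      ultimately show ?thesis by (simp add: B(1) adele_box_def)
    qed
    then show ?case using M \<eta>(1) by blast
  qed
  then obtain M \<eta> where "M > 0" "\<eta> > 0" "\<And>w. near M \<eta> w \<Longrightarrow> x + w \<in> U" by blast
  then show ?thesis by (intro that[of M \<eta>]) (auto simp: near_def)
qed

text \<open>Division by \<open>M\<close> turns the \<open>p\<close>-adic conditions into
  integrality, which every class satisfies for some representative. What remains is smallness of the
  real coordinate modulo 1, and the standard character detects it.\<close>

lemma open_mod_Q_nbhd:
  assumes "open U" "\<beta> \<in> U"
  obtains M :: nat and \<epsilon> :: real where "M > 0" "\<epsilon> > 0"
    "\<And>\<alpha>. norm (std_character (rat_act (1 / of_nat M) \<alpha>) - std_character (rat_act (1 / of_nat M) \<beta>)) < \<epsilon> \<Longrightarrow> \<alpha> \<in> U"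
proof -
  obtain x where x: "mod_Q x = \<beta>" by (rule mod_Q_rep)
  have "open (mod_Q -` U)" using assms(1) by (simp add: open_adele_mod_Q_def)
  moreover have "x \<in> mod_Q -` U" using x assms(2) by simp
  ultimately obtain M \<eta> where M: "M > 0" "\<eta> > 0"
    and nb: "\<And>w. \<bar>adele_real w\<bar> < \<eta> \<Longrightarrow>
      (\<And>p. prime p \<Longrightarrow> Qp_norm p (adele_padic w p) \<le> padic_abs p (of_nat M)) \<Longrightarrow> x + w \<in> mod_Q -` U"
    using open_adele_nbhd by metis
  \<comment> \<open>The angle of a real coordinate of size \<open>\<eta> / M\<close>, which
    multiplication by \<open>M\<close> brings back to \<eta>.\<close>
  define B where "B = 2 * pi * (\<eta> / real M)"
  have "B > 0" using M by (simp add: B_def)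
  moreover have "isCont Arg 1" by (intro continuous_at_Arg) simp
  ultimately obtain \<epsilon> where \<epsilon>: "\<epsilon> > 0" "\<And>z. norm (z - 1) < \<epsilon> \<Longrightarrow> \<bar>Arg z\<bar> < B"
    unfolding continuous_at_eps_delta dist_norm by (auto simp: Arg_1)
  show ?thesis
  proof (rule that[OF M(1) \<epsilon>(1)])
    fix \<alpha>
    assume close: "norm (std_character (rat_act (1 / of_nat M) \<alpha>) - std_character (rat_act (1 / of_nat M) \<beta>)) < \<epsilon>"
    define \<delta> where "\<delta> = rat_act (1 / of_nat M) (\<alpha> - \<beta>)"
    obtain a where a: "mod_Q a = \<alpha> - \<beta>" by (rule mod_Q_rep)
    obtain y where y: "mod_Q y = \<delta>" "y \<in> integral_adeles" "adele_real y = real_coord \<delta>"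
      by (rule mod_Q_rep)
    have "rat_act (1 / of_nat M) \<alpha> = \<delta> + rat_act (1 / of_nat M) \<beta>"
      using rat_act_add_right[of "1 / of_nat M" "\<alpha> - \<beta>" \<beta>] by (simp add: \<delta>_def)
    then have "std_character (rat_act (1 / of_nat M) \<alpha>) - std_character (rat_act (1 / of_nat M) \<beta>)
        = (std_character \<delta> - 1) * std_character (rat_act (1 / of_nat M) \<beta>)"
      by (simp add: std_character_add algebra_simps)
    then have c1: "norm (std_character \<delta> - 1) < \<epsilon>"
      using close by (simp add: norm_mult std_character_def[of "rat_act _ _"])
    \<comment> \<open>Since \<open>Arg\<close> is centred at 0, no case distinction is needed for \<open>real_coord \<delta>\<close> near 1.\<close>
    define A where "A = Arg (std_character \<delta>) / (2 * pi)"
    have "cis (2 * pi * real_coord \<delta>) = cis (2 * pi * A)"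
      using cis_Arg[of "std_character \<delta>"] by (simp add: A_def std_character_def sgn_div_norm)
    then obtain n :: int where n: "real_coord \<delta> = A + of_int n" by (rule cis_2pi_eqE)
    \<comment> \<open>An integral representative of \<delta> whose real coordinate is the small
      number \<open>A\<close>; its multiple \<open>w\<close> by \<open>M\<close> represents
      \<open>\<alpha> - \<beta>\<close> and satisfies the conditions at every prime.\<close>
    define v where "v = y - adele_of_rat (of_int n)"
    have v: "v \<in> integral_adeles"
      unfolding v_def by (intro integral_adeles_diff y integral_adeles_of_int)
    have "\<bar>adele_real v\<bar> = \<bar>Arg (std_character \<delta>)\<bar> / (2 * pi)"
      by (simp add: v_def adele_real_diff y(3) n A_def)
    also have "\<dots> < \<eta> / real M"
      using \<epsilon>(2)[OF c1] by (subst pos_divide_less_eq) (simp_all add: B_def mult.commute)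
    finally have rv: "\<bar>adele_real v\<bar> < \<eta> / real M" .
    define w where "w = adele_of_rat (of_nat M) * v"
    have "x + w \<in> mod_Q -` U"
    proof (rule nb)
      show "\<bar>adele_real w\<bar> < \<eta>"
        using rv M by (simp add: w_def adele_real_ops abs_mult field_simps)
      fix p :: nat assume p: "prime p"
      have "Qp_norm p (adele_padic v p) \<le> 1" "adele_padic v p \<in> carrier (Qp p)"
        using integral_adeles_padic[OF v p] by (simp_all add: Zp_def)
      then show "Qp_norm p (adele_padic w p) \<le> padic_abs p (of_nat M)"
        by (simp add: w_def adele_padic_ops[OF p] p Qp_norm_mult[OF p] Qp_of_rat_carrier[OF p]
            Qp_norm_of_rat[OF p] mult_left_le)
    qed
    moreover have "mod_Q w = \<alpha> - \<beta>"
    proof -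
      have "mod_Q v = \<delta>"
        unfolding y(1)[symmetric] mod_Q_eq_iff v_def
        by (rule exI[of _ "- of_int n"]) (simp add: adele_of_rat_minus)
      then have "mod_Q w = rat_act (of_nat M) \<delta>" by (simp add: w_def flip: rat_act_mod_Q)
      also have "\<dots> = rat_act 1 (\<alpha> - \<beta>)" using M by (simp add: \<delta>_def rat_act_rat_act)
      also have "\<dots> = \<alpha> - \<beta>" by (simp flip: a add: rat_act_mod_Q)
      finally show ?thesis .
    qed
    ultimately show "\<alpha> \<in> U" by (simp add: mod_Q_add x)
  qed
qed

theorem theorem1p1:
  fixes \<gamma> :: rat and \<delta> :: int and \<Sigma> :: "rat set" and \<alpha> :: adele_mod_Q
  assumes "mult_independent \<gamma> (of_int \<delta>)"
    and "\<Sigma> = {\<gamma> ^ a * of_int \<delta> ^ b | a b :: nat. a \<ge> 1 \<and> b \<ge> 1}"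
    and "real_coord \<alpha> \<notin> \<rat>"
  shows "closure ((\<lambda>\<sigma>. rat_act \<sigma> \<alpha>) ` \<Sigma>) = UNIV"
proof -
  have meets: "U \<inter> (\<lambda>\<sigma>. rat_act \<sigma> \<alpha>) ` \<Sigma> \<noteq> {}" if U: "open U" "\<beta> \<in> U" for U \<beta>
  proof -
    obtain M :: nat and \<epsilon> :: real where M: "M > 0" "\<epsilon> > 0"
      and nb: "\<And>\<alpha>. norm (std_character (rat_act (1 / of_nat M) \<alpha>) -
        std_character (rat_act (1 / of_nat M) \<beta>)) < \<epsilon> \<Longrightarrow> \<alpha> \<in> U"
      using open_mod_Q_nbhd[OF U] by metis
    \<comment> \<open>The character of the rationals attached to \<open>\<alpha> / M\<close>.
      Irrationality of the real coordinate makes its values at nonzero rationals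
      non-torsion.\<close>
    define f where "f = (\<lambda>q. std_character (rat_act (1 / of_nat M * q) \<alpha>))"
    have "\<exists>a\<ge>1. \<exists>b\<ge>1. norm (f (\<gamma> ^ a * of_int \<delta> ^ b) - std_character (rat_act (1 / of_nat M) \<beta>)) < \<epsilon>"
    proof (rule character_values_dense[OF _ _ _ assms(1) _ M(2)])
      show "f (x + y) = f x * f y" for x y
        by (simp add: f_def rat_act_add std_character_add distrib_left add_divide_distrib)
      show "f x ^ n \<noteq> 1" if "x \<noteq> 0" "n > 0" for x n
        unfolding f_def using that M(1)
        by (intro std_character_nontorsion real_coord_rat_act_irrational assms(3)) simp_all
    qed (simp_all add: f_def std_character_def)
    then obtain a b where ab: "a \<ge> 1" "b \<ge> 1"
      "norm (f (\<gamma> ^ a * of_int \<delta> ^ b) - std_character (rat_act (1 / of_nat M) \<beta>)) < \<epsilon>" by blast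
    then have "rat_act (\<gamma> ^ a * of_int \<delta> ^ b) \<alpha> \<in> U"
      by (intro nb) (simp add: f_def rat_act_rat_act)
    moreover have "\<gamma> ^ a * of_int \<delta> ^ b \<in> \<Sigma>" using ab(1,2) assms(2) by blast
    ultimately show ?thesis by blast
  qed
  \<comment> \<open>A point outside the closure would have this open complement as a neighbourhood,
    which cannot meet the orbit.\<close>
  have "open (- closure ((\<lambda>\<sigma>. rat_act \<sigma> \<alpha>) ` \<Sigma>))" by (rule open_Compl[OF closed_closure])
  from meets[OF this] show ?thesis using closure_subset[of "(\<lambda>\<sigma>. rat_act \<sigma> \<alpha>) ` \<Sigma>"] by auto
qed

end
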